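(* Let $\omega\ge4$, $\Gamma_\omega:=\left[\frac{2}{\sqrt\omega},\frac{\sqrt\omega}{2}\right]$, and for $\gamma\in\Gamma_\omega$ let $V(\gamma)=|\Omega^\omega_\gamma|$ be the volume of $\Omega^\omega_\gamma$. If $\omega>4$, then for $\gamma\in\Gamma_\omega$ $$V'(\gamma)<0\ \text{ for }\gamma<1,\qquad V'(1)=0,\qquad V'(\gamma)>0\ \text{ for }\gamma>1.$$ For $\omega=4$, the admissible interval reduces to the single point $\Gamma_\omega=\{1\}$.
   Context: $|\cdot|$ denotes Lebesgue measure in $\mathbb R^3$. At the endpoints of $\Gamma_\omega$ derivatives are understood as one-sided derivatives (from within $\Gamma_\omega$). The domains $\Omega^\omega_\gamma\subset\mathbb R^3$. Let $\alpha=\pi/2$. In the first octant $\{x,y,z\ge0\}$ define seven closed pieces: $[\mathrm C]=\{0\le x,y,z\le\alpha\}$; $[\mathrm Z]=\{0\le x,y\le\alpha,\ \alpha\le z\le\alpha+\sqrt\omega\arcsin(\frac{\gamma}{\sqrt\omega}(\cos x+\cos y))\}$; $[\mathrm X]=\{0\le y,z\le\alpha,\ \alpha\le x\le\alpha+\sqrt\omega\arcsin(\frac{\gamma\cos y+\cos z}{\gamma\sqrt\omega})\}$; $[\mathrm Y]=\{0\le x,z\le\alpha,\ \alpha\le y\le\alpha+\sqrt\omega\arcsin(\frac{\gamma\cos x+\cos z}{\gamma\sqrt\omega})\}$; $[\mathrm{ZX}]=\{\alpha\le x\le\alpha+\sqrt\omega\arcsin(\frac1{\sqrt\omega}),\ \alpha\le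 z\le\alpha+\sqrt\omega\arcsin(\frac{\gamma}{\sqrt\omega}),\ 0\le\theta\le1,\ 0\le y\le\arccos\theta\}$ with $\theta=\sqrt\omega\sin(\frac{x-\alpha}{\sqrt\omega})+\frac{\sqrt\omega}{\gamma}\sin(\frac{z-\alpha}{\sqrt\omega})$; $[\mathrm{XY}]=\{\alpha\le x,y\le\alpha+\sqrt\omega\arcsin(\frac1{\gamma\sqrt\omega}),\ 0\le\theta\le1,\ 0\le z\le\arccos\theta\}$ with $\theta=\gamma\sqrt\omega\sin(\frac{x-\alpha}{\sqrt\omega})+\gamma\sqrt\omega\sin(\frac{y-\alpha}{\sqrt\omega})$; $[\mathrm{YZ}]=\{\alpha\le y\le\alpha+\sqrt\omega\arcsin(\frac1{\sqrt\omega}),\ \alpha\le z\le\alpha+\sqrt\omega\arcsin(\frac{\gamma}{\sqrt\omega}),\ 0\le\theta\le1,\ 0\le x\le\arccos\theta\}$ with $\theta=\sqrt\omega\sin(\frac{y-\alpha}{\sqrt\omega})+\frac{\sqrt\omega}{\gamma}\sin(\frac{z-\alpha}{\sqrt\omega})$. (For $\gamma\in\Gamma_\omega$ all inverse trigonometric expressions, on principal branches, are well defined.) Let $K$ be the union of the seven pieces. $\Omega^\omega_\gamma$ is the interior of the reflected union $\{(\sigma_1x,\sigma_2y,\sigma_3z):(x,y,z)\in K,\ \sigma_i\in\{-1,1\}\}$. *)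

theory Defs
  imports "HOL-Analysis.Analysis"
begin

definition Gamma_int :: "real \<Rightarrow> real set" where
  "Gamma_int \<omega> = {2 / sqrt \<omega> .. sqrt \<omega> / 2}"

abbreviation \<alpha> :: real where "\<alpha> \<equiv> pi / 2"

text \<open>
  Euclidean 3-space is rendered as \<^typ>\<open>real \<times> real \<times> real\<close>, with its product topology and its
  standard Lebesgue measure. The total functions \<^const>\<open>arcsin\<close> and \<^const>\<open>arccos\<close> are the principal
  branches on \<open>[-1, 1]\<close>; for \<open>\<gamma> \<in> Gamma_int \<omega>\<close> and \<open>\<omega> \<ge> 4\<close> they are only evaluated there
  (in the last three pieces, the bound \<open>arccos \<theta>\<close> is accompanied by \<open>0 \<le> \<theta> \<le> 1\<close>).
\<close>

definition piece_C :: "(real \<times> real \<times> real) set" where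
  "piece_C = {(x, y, z). 0 \<le> x \<and> x \<le> \<alpha> \<and> 0 \<le> y \<and> y \<le> \<alpha> \<and> 0 \<le> z \<and> z \<le> \<alpha>}"

definition piece_Z :: "real \<Rightarrow> real \<Rightarrow> (real \<times> real \<times> real) set" where
  "piece_Z \<omega> \<gamma> = {(x, y, z). 0 \<le> x \<and> x \<le> \<alpha> \<and> 0 \<le> y \<and> y \<le> \<alpha> \<and>
     \<alpha> \<le> z \<and> z \<le> \<alpha> + sqrt \<omega> * arcsin (\<gamma> / sqrt \<omega> * (cos x + cos y))}"

definition piece_X :: "real \<Rightarrow> real \<Rightarrow> (real \<times> real \<times> real) set" where
  "piece_X \<omega> \<gamma> = {(x, y, z). 0 \<le> y \<and> y \<le> \<alpha> \<and> 0 \<le> z \<and> z \<le> \<alpha> \<and>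
     \<alpha> \<le> x \<and> x \<le> \<alpha> + sqrt \<omega> * arcsin ((\<gamma> * cos y + cos z) / (\<gamma> * sqrt \<omega>))}"

definition piece_Y :: "real \<Rightarrow> real \<Rightarrow> (real \<times> real \<times> real) set" where
  "piece_Y \<omega> \<gamma> = {(x, y, z). 0 \<le> x \<and> x \<le> \<alpha> \<and> 0 \<le> z \<and> z \<le> \<alpha> \<and>
     \<alpha> \<le> y \<and> y \<le> \<alpha> + sqrt \<omega> * arcsin ((\<gamma> * cos x + cos z) / (\<gamma> * sqrt \<omega>))}"

definition piece_ZX :: "real \<Rightarrow> real \<Rightarrow> (real \<times> real \<times> real) set" where
  "piece_ZX \<omega> \<gamma> = {(x, y, z).
     let \<theta> = sqrt \<omega> * sin ((x - \<alpha>) / sqrt \<omega>) + sqrt \<omega> / \<gamma> * sin ((z - \<alpha>) / sqrt \<omega>) in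
       \<alpha> \<le> x \<and> x \<le> \<alpha> + sqrt \<omega> * arcsin (1 / sqrt \<omega>) \<and>
       \<alpha> \<le> z \<and> z \<le> \<alpha> + sqrt \<omega> * arcsin (\<gamma> / sqrt \<omega>) \<and>
       0 \<le> \<theta> \<and> \<theta> \<le> 1 \<and> 0 \<le> y \<and> y \<le> arccos \<theta>}"

definition piece_XY :: "real \<Rightarrow> real \<Rightarrow> (real \<times> real \<times> real) set" where
  "piece_XY \<omega> \<gamma> = {(x, y, z).
     let \<theta> = \<gamma> * sqrt \<omega> * sin ((x - \<alpha>) / sqrt \<omega>) + \<gamma> * sqrt \<omega> * sin ((y - \<alpha>) / sqrt \<omega>) in
       \<alpha> \<le> x \<and> x \<le> \<alpha> + sqrt \<omega> * arcsin (1 / (\<gamma> * sqrt \<omega>)) \<and>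
       \<alpha> \<le> y \<and> y \<le> \<alpha> + sqrt \<omega> * arcsin (1 / (\<gamma> * sqrt \<omega>)) \<and>
       0 \<le> \<theta> \<and> \<theta> \<le> 1 \<and> 0 \<le> z \<and> z \<le> arccos \<theta>}"

definition piece_YZ :: "real \<Rightarrow> real \<Rightarrow> (real \<times> real \<times> real) set" where
  "piece_YZ \<omega> \<gamma> = {(x, y, z).
     let \<theta> = sqrt \<omega> * sin ((y - \<alpha>) / sqrt \<omega>) + sqrt \<omega> / \<gamma> * sin ((z - \<alpha>) / sqrt \<omega>) in
       \<alpha> \<le> y \<and> y \<le> \<alpha> + sqrt \<omega> * arcsin (1 / sqrt \<omega>) \<and>
       \<alpha> \<le> z \<and> z \<le> \<alpha> + sqrt \<omega> * arcsin (\<gamma> / sqrt \<omega>) \<and>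
       0 \<le> \<theta> \<and> \<theta> \<le> 1 \<and> 0 \<le> x \<and> x \<le> arccos \<theta>}"

definition octant_K :: "real \<Rightarrow> real \<Rightarrow> (real \<times> real \<times> real) set" where
  "octant_K \<omega> \<gamma> = piece_C \<union> piece_Z \<omega> \<gamma> \<union> piece_X \<omega> \<gamma> \<union> piece_Y \<omega> \<gamma> \<union>
     piece_ZX \<omega> \<gamma> \<union> piece_XY \<omega> \<gamma> \<union> piece_YZ \<omega> \<gamma>"

definition Omega_dom :: "real \<Rightarrow> real \<Rightarrow> (real \<times> real \<times> real) set" where
  "Omega_dom \<omega> \<gamma> = interior {(\<sigma>\<^sub>1 * x, \<sigma>\<^sub>2 * y, \<sigma>\<^sub>3 * z) | \<sigma>\<^sub>1 \<sigma>\<^sub>2 \<sigma>\<^sub>3 x y z.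
     (x, y, z) \<in> octant_K \<omega> \<gamma> \<and> \<sigma>\<^sub>1 \<in> {-1, 1} \<and> \<sigma>\<^sub>2 \<in> {-1, 1} \<and> \<sigma>\<^sub>3 \<in> {-1, 1}}"

definition Vol :: "real \<Rightarrow> real \<Rightarrow> real" where
  "Vol \<omega> \<gamma> = measure lebesgue (Omega_dom \<omega> \<gamma>)"

end

theory Submission
  imports Defs
begin

text \<open>
  Put \<open>r = sqrt \<omega>\<close> and extend \<open>cos\<close> from \<open>[0, pi/2]\<close> to a strictly decreasing function \<open>prof r\<close> on
  \<open>[0, \<infinity>)\<close> that equals \<open>- r sin ((x - pi/2) / r)\<close> beyond \<open>pi/2\<close>. All seven pieces together are
  then the region \<open>prof r x + prof r y + prof r z / \<gamma> \<ge> 0\<close> of the octant. Its part with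
  \<open>z > pi/2\<close> is measured along \<open>z\<close>, the rest along \<open>y\<close> or \<open>x\<close>; this gives an eighth of the volume as
  \<open>Z(\<gamma>) + N(1/\<gamma>)\<close> plus a constant, where \<open>Z\<close> and \<open>N\<close> are integrals, over domains independent
  of \<open>\<gamma>\<close>, of \<open>r arcsin\<close> of affine functions of the parameter. As \<open>arcsin\<close> is convex on \<open>[0, 1]\<close>, \<open>Z'\<close>
  and \<open>N'\<close> are nondecreasing, and a reflection argument yields \<open>Z'(1) = N'(1) > 0\<close>. Hence
  \<open>Z'(\<gamma>) - N'(1/\<gamma>) / \<gamma>\<^sup>2\<close> has the sign of \<open>\<gamma> - 1\<close>.
\<close>

section \<open>The extended cosine profile\<close>

text \<open>Inverting \<open>arcsin\<close> turns a bound
  \<open>z \<le> pi/2 + r * arcsin (s / r)\<close> into \<open>- prof r z \<le> s\<close>; this is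
  what gives all pieces one common inequality. The linear tail starts at
  \<open>pi/2 + r * (pi/2)\<close>, where the sine would turn back; it keeps the profile strictly
  decreasing, and the domain does not enter it. Two features of the section length as a function of
  \<open>s\<close> shape the analysis: a kink at \<open>s = 0\<close> and an infinite slope at
  \<open>s = r\<close>. The kink is met on null sets only. The infinite slope is met at the endpoint
  \<open>\<gamma> = r / 2\<close>, where the slices along \<open>z\<close> attain
  \<open>s = r\<close> at the origin, so integrability of the slope has to be proved there. For the
  other slices \<open>s \<le> r / 2 + 1\<close>, which is below \<open>r\<close> because
  \<open>\<omega> > 4\<close>. Solving for \<open>z\<close> makes the argument of
  \<open>arcsin\<close> linear in \<open>\<gamma>\<close>, solving for \<open>x\<close> or
  \<open>y\<close> makes it affine in \<open>1 / \<gamma>\<close>; the parameter interval is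
  invariant under inversion, so both families are differentiated on the same interval.\<close>

definition prof :: "real \<Rightarrow> real \<Rightarrow> real" where
  "prof r x = cos (min x (pi/2)) - r * sin (max 0 (min ((x - pi/2) / r) (pi/2)))
     - max 0 (x - pi/2 - r * (pi/2))"

lemma continuous_on_prof [continuous_intros]:
  fixes f :: "'a::t2_space \<Rightarrow> real"
  assumes "r > 0" "continuous_on S f"
  shows "continuous_on S (\<lambda>p. prof r (f p))"
  unfolding prof_def using assms
  by (intro continuous_intros) auto

lemma prof_le:
  assumes "0 < r" "x \<le> pi/2"
  shows "prof r x = cos x"
proof -
  have "min ((x - pi/2) / r) (pi/2) \<le> 0"
    using assms by (simp add: divide_le_0_iff min_le_iff_disj)
  moreover have "0 \<le> r * (pi/2)" using assms by simp
  then have "x - pi/2 - r * (pi/2) \<le> 0" using assms(2) by linarith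
  ultimately show ?thesis using assms by (simp add: prof_def max_absorb1 min_absorb1)
qed

lemma prof_ge:
  assumes "0 < r" "pi/2 \<le> x" "x \<le> pi/2 + r * (pi/2)"
  shows "prof r x = - r * sin ((x - pi/2) / r)"
proof -
  have "0 \<le> (x - pi/2) / r" "(x - pi/2) / r \<le> pi/2"
    using assms by (auto simp: field_simps)
  moreover have "cos (min x (pi/2)) = 0"
    using assms by (simp add: min_absorb2)
  ultimately show ?thesis using assms by (simp add: prof_def max_absorb1 max_absorb2 min_absorb1)
qed

lemma prof_0 [simp]: "r > 0 \<Longrightarrow> prof r 0 = 1"
  by (subst prof_le) auto

text \<open>None of the three summands increases; which of them decreases strictly depends only on
  the range that contains the smaller point \<open>x\<close>.\<close>

lemma prof_strict_antimono:
  assumes r: "0 < r" and "0 \<le> x" "x < y"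
  shows "prof r y < prof r x"
proof -
  have c: "cos (min y (pi/2)) \<le> cos (min x (pi/2))"
    using assms by (intro cos_monotone_0_pi_le) (auto simp: min_le_iff_disj)
  have s: "sin (max 0 (min ((x - pi/2) / r) (pi/2))) \<le> sin (max 0 (min ((y - pi/2) / r) (pi/2)))"
    using assms pi_half_ge_zero
    by (intro sin_monotone_2pi_le max.mono min.mono divide_right_mono max.boundedI min.cobounded2
        le_max_iff_disj[THEN iffD2]) auto
  have s': "r * sin (max 0 (min ((x - pi/2) / r) (pi/2))) \<le> r * sin (max 0 (min ((y - pi/2) / r) (pi/2)))"
    using s r by simp
  have l: "max 0 (x - pi/2 - r * (pi/2)) \<le> max 0 (y - pi/2 - r * (pi/2))"
    using assms by auto
  consider "x < pi/2" | "x \<ge> pi/2" "x < pi/2 + r * (pi/2)" | "x \<ge> pi/2 + r * (pi/2)" by linarith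
  then show ?thesis
  proof cases
    case 1
    then have "cos (min y (pi/2)) < cos (min x (pi/2))"
      using assms by (intro cos_monotone_0_pi) (auto simp: min_le_iff_disj)
    then show ?thesis using s' l unfolding prof_def by linarith
  next
    case 2
    have "0 \<le> (x - pi/2) / r" "(x - pi/2) / r < pi/2" "(x - pi/2) / r < (y - pi/2) / r"
      using 2 r assms(3) by (auto simp: field_simps divide_strict_right_mono)
    moreover have "sin (max 0 (min u (pi/2))) < sin (max 0 (min v (pi/2)))"
      if "0 \<le> u" "u < pi/2" "u < v" for u v :: real
      using that by (intro sin_monotone_2pi) (simp_all add: max_def min_def)
    ultimately have "sin (max 0 (min ((x - pi/2) / r) (pi/2))) < sin (max 0 (min ((y - pi/2) / r) (pi/2)))"
      by blast
    then have "r * sin (max 0 (min ((x - pi/2) / r) (pi/2))) < r * sin (max 0 (min ((y - pi/2) / r) (pi/2)))"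
      using r by simp
    then show ?thesis using c l unfolding prof_def by linarith
  next
    case 3
    then show ?thesis using c s' assms(3) unfolding prof_def by linarith
  qed
qed

lemma prof_le_iff: "0 < r \<Longrightarrow> 0 \<le> x \<Longrightarrow> 0 \<le> y \<Longrightarrow> prof r x \<le> prof r y \<longleftrightarrow> y \<le> x"
  using prof_strict_antimono[of r x y] prof_strict_antimono[of r y x] by (cases x y rule: linorder_cases) auto

lemma prof_less_iff: "0 < r \<Longrightarrow> 0 \<le> x \<Longrightarrow> 0 \<le> y \<Longrightarrow> prof r x < prof r y \<longleftrightarrow> y < x"
  using prof_le_iff[of r y x] by auto

lemma prof_le_1: "0 < r \<Longrightarrow> 0 \<le> x \<Longrightarrow> prof r x \<le> 1"
  using prof_le_iff[of r x 0] by simp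

lemma prof_nonneg_iff: "0 < r \<Longrightarrow> 0 \<le> x \<Longrightarrow> 0 \<le> prof r x \<longleftrightarrow> x \<le> pi/2"
  using prof_le_iff[of r "pi/2" x] by (simp add: prof_le)

section \<open>Lengths of sections and their slope\<close>

definition seclen :: "real \<Rightarrow> real \<Rightarrow> real" where
  "seclen r s = r * arcsin (max 0 (min 1 (s / r)))"

text \<open>Slope of \<open>seclen\<close>. The clamp in \<open>seclen\<close> makes it constant for
  \<open>s \<le> 0\<close>; at the kink \<open>s = 0\<close> the one-sided slopes are 0 and 1, and
  the value 0 is a convention.\<close>

definition seclen' :: "real \<Rightarrow> real \<Rightarrow> real" where
  "seclen' r s = (if 0 < s then 1 / sqrt (1 - (s/r)\<^sup>2) else 0)"

lemma seclen_nonneg: "0 < r \<Longrightarrow> 0 \<le> seclen r s"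
  unfolding seclen_def by (intro mult_nonneg_nonneg arcsin_nonneg) auto

lemma seclen_le: "0 < r \<Longrightarrow> seclen r s \<le> r * (pi/2)"
  unfolding seclen_def by (intro mult_left_mono arcsin_ubound) auto

lemma seclen_eq: "0 < r \<Longrightarrow> 0 \<le> s \<Longrightarrow> s \<le> r \<Longrightarrow> seclen r s = r * arcsin (s/r)"
  by (simp add: seclen_def)

lemma seclen_nonpos: "0 < r \<Longrightarrow> s \<le> 0 \<Longrightarrow> seclen r s = 0"
  by (simp add: seclen_def divide_le_0_iff max_absorb1 min_le_iff_disj)

lemma continuous_on_seclen [continuous_intros]:
  assumes "continuous_on S f"
  shows "continuous_on S (\<lambda>p. seclen r (f p))"
  unfolding seclen_def using assms
  by (cases "r = 0") (auto intro!: continuous_intros)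

lemma borel_measurable_seclen [measurable]: "seclen r \<in> borel_measurable borel"
  by (intro borel_measurable_continuous_onI continuous_on_seclen continuous_on_id)

lemma borel_measurable_seclen' [measurable]: "seclen' r \<in> borel_measurable borel"
  unfolding seclen'_def[abs_def] by measurable

lemma borel_measurable_prof [measurable]: "prof r \<in> borel_measurable borel"
  unfolding prof_def[abs_def] by measurable

lemma prof_seclen:
  assumes "0 < r" "0 \<le> s" "s \<le> r"
  shows "prof r (pi/2 + seclen r s) = - s"
proof -
  have "s / r \<le> 1" using assms by simp
  then show ?thesis
    using assms seclen_nonneg[of r s] seclen_le[of r s]
    by (subst prof_ge) (simp_all add: seclen_eq order_trans[of "-1" 0])
qed

text \<open>\<open>prof r\<close> and \<open>seclen r\<close> are inverse to each other up to sign and shift, so the sections of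
  the domain have length \<open>seclen\<close>.\<close>

lemma le_seclen_iff:
  assumes "0 < r" "0 \<le> s" "s \<le> r" "pi/2 \<le> x"
  shows "x \<le> pi/2 + seclen r s \<longleftrightarrow> - prof r x \<le> s"
proof -
  have "0 \<le> x" "0 \<le> pi/2 + seclen r s"
    using assms seclen_nonneg[of r s] pi_half_ge_zero by linarith+
  then have "prof r (pi/2 + seclen r s) \<le> prof r x \<longleftrightarrow> x \<le> pi/2 + seclen r s"
    using assms by (intro prof_le_iff) auto
  then show ?thesis using prof_seclen[OF assms(1-3)] by linarith
qed

text \<open>For \<open>s < 0\<close> the section is empty, because the profile is negative beyond
  \<open>pi/2\<close>; the clamp in \<open>seclen\<close> gives the matching value 0.\<close>

lemma emeasure_section:
  assumes "0 < r" "s \<le> r"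
  shows "emeasure lborel {x. pi/2 < x \<and> 0 \<le> prof r x + s} = ennreal (seclen r s)"
proof (cases "0 \<le> s")
  case True
  have "{x. pi/2 < x \<and> 0 \<le> prof r x + s} = {pi/2<..pi/2 + seclen r s}"
    using le_seclen_iff[OF assms(1) True assms(2)] by (intro set_eqI) (auto simp: less_imp_le)
  then show ?thesis using seclen_nonneg[OF assms(1)] by simp
next
  case False
  have "prof r x + s < 0" if "pi/2 < x" for x
    using that False prof_nonneg_iff[OF assms(1), of x] pi_half_ge_zero by linarith
  then have "{x. pi/2 < x \<and> 0 \<le> prof r x + s} = {}"
    by (auto simp: not_le)
  then show ?thesis using assms False by (simp only:) (simp add: seclen_nonpos)
qed

text \<open>This is the convexity of \<open>arcsin\<close>: the slope jumps up at
  \<open>s = 0\<close> and increases afterwards. The domination and the monotonicity of the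
  derivative integrals both rest on it.\<close>

lemma seclen'_mono:
  assumes "0 < r" "s \<le> s'" "s' < r"
  shows "seclen' r s \<le> seclen' r s'"
proof -
  have "(s'/r)\<^sup>2 < 1" if "0 < s'" using that assms by (simp add: power2_eq_square field_simps mult_strict_mono')
  moreover have "(s/r)\<^sup>2 \<le> (s'/r)\<^sup>2" if "0 < s"
    using assms that by (intro power_mono divide_right_mono) auto
  ultimately show ?thesis using assms
    by (cases "0 < s") (auto simp: seclen'_def frac_le less_imp_le)
qed

lemma seclen'_nonneg: "0 < r \<Longrightarrow> s < r \<Longrightarrow> 0 \<le> seclen' r s"
  using seclen'_mono[of r "min s 0" s] by (simp add: seclen'_def)

lemma seclen'_ge_1:
  assumes "0 < s" "s < r"
  shows "1 \<le> seclen' r s"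
proof -
  have "(s/r)\<^sup>2 < 1" using assms by (simp add: power2_eq_square field_simps mult_strict_mono')
  then show ?thesis using assms by (simp add: seclen'_def)
qed

lemma DERIV_seclen:
  assumes "0 < r" "s < r" "s \<noteq> 0"
  shows "(seclen r has_real_derivative seclen' r s) (at s)"
proof (cases "0 < s")
  case True
  have "((\<lambda>s. r * arcsin (s/r)) has_real_derivative seclen' r s) (at s)"
    using assms True by (auto intro!: derivative_eq_intros simp: seclen'_def divide_simps)
  then show ?thesis
    by (rule has_field_derivative_transform_within_open[where S = "{0<..<r}"])
       (use assms True in \<open>auto simp: seclen_eq\<close>)
next
  case False
  have "((\<lambda>s. 0) has_real_derivative seclen' r s) (at s)"
    using False by (simp add: seclen'_def)
  then show ?thesis
    by (rule has_field_derivative_transform_within_open[where S = "{..<0}"])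
       (use assms False in \<open>auto simp: seclen_nonpos\<close>)
qed

text \<open>Mean value theorem; by convexity the slope at the right end is the largest one.\<close>

lemma seclen_lipschitz:
  assumes r: "0 < r" and s: "s \<le> s'" "s' < r"
  shows "\<bar>seclen r s' - seclen r s\<bar> \<le> seclen' r s' * (s' - s)"
proof (cases "s' \<le> 0")
  case True
  then show ?thesis using assms by (simp add: seclen_nonpos seclen'_def)
next
  case False
  \<comment> \<open>Cuts off the flat part left of the kink, so that the interior of the remaining
    interval consists of points of differentiability; the value of \<open>seclen\<close> is
    unchanged.\<close>
  define s0 where "s0 = max s 0"
  have s0: "0 \<le> s0" "s0 \<le> s'" "seclen r s = seclen r s0" "s' - s0 \<le> s' - s"
    using False s r by (auto simp: s0_def max_def seclen_nonpos)
  have "\<exists>l z. s0 < z \<and> z < s' \<and> DERIV (seclen r) z :> l \<and> seclen r s' - seclen r s0 = (s' - s0) * l" if "s0 < s'"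
    by (rule MVT) (use that s0 s r in \<open>auto intro!: continuous_on_seclen simp: real_differentiable_def intro!: exI DERIV_seclen\<close>)
  then have "\<bar>seclen r s' - seclen r s0\<bar> \<le> (s' - s0) * seclen' r s'"
  proof (cases "s0 < s'")
    case True
    with \<open>s0 < s' \<Longrightarrow> _\<close> obtain l z where z: "s0 < z" "z < s'" "DERIV (seclen r) z :> l"
      "seclen r s' - seclen r s0 = (s' - s0) * l" by blast
    then have "l = seclen' r z" using DERIV_seclen[of r z] s0 s r by (auto intro: DERIV_unique)
    then show ?thesis using z seclen'_mono[of r z s'] seclen'_nonneg[of r z] s r
      by (auto simp: abs_mult intro!: mult_mono)
  next
    case False
    then have "s0 = s'" using s0 by simp
    then show ?thesis by simp
  qed
  also have "\<dots> \<le> (s' - s) * seclen' r s'"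
    using s0 seclen'_nonneg[of r s'] r s by (intro mult_right_mono) auto
  finally show ?thesis using s0 by (simp add: mult.commute)
qed

section \<open>Differentiating integrals of section lengths\<close>

text \<open>Dominated convergence for difference quotients along sequences in \<open>S\<close>.
  Differentiability is asked only at \<open>x0\<close> and almost everywhere, which tolerates the
  kink, and derivatives within \<open>S\<close> cover the endpoints.\<close>

lemma has_real_derivative_integral:
  fixes f :: "real \<Rightarrow> 'a \<Rightarrow> real"
  assumes x0: "x0 \<in> S" and int: "\<And>x. x \<in> S \<Longrightarrow> integrable M (f x)"
    and meas: "f' \<in> borel_measurable M" and w: "integrable M w"
    and der: "AE p in M. ((\<lambda>x. f x p) has_real_derivative f' p) (at x0 within S)"
    and lip: "\<And>x. x \<in> S \<Longrightarrow> AE p in M. \<bar>f x p - f x0 p\<bar> \<le> w p * \<bar>x - x0\<bar>"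
  shows "((\<lambda>x. \<integral>p. f x p \<partial>M) has_real_derivative (\<integral>p. f' p \<partial>M)) (at x0 within S)"
proof -
  let ?q = "\<lambda>x p. (f x p - f x0 p) / (x - x0)"
  have "((\<lambda>x. \<integral>p. ?q x p \<partial>M) \<longlongrightarrow> (\<integral>p. f' p \<partial>M)) (at x0 within S)"
    unfolding tendsto_at_iff_sequentially
  proof (intro allI impI)
    fix X assume X: "\<forall>i. X i \<in> S - {x0}" "X \<longlonglongrightarrow> x0"
    show "((\<lambda>x. \<integral>p. ?q x p \<partial>M) \<circ> X) \<longlonglongrightarrow> (\<integral>p. f' p \<partial>M)"
      unfolding comp_def
    proof (rule integral_dominated_convergence[where w = w])
      show "?q (X i) \<in> borel_measurable M" for i
        using int[of "X i"] int[OF x0] X by auto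
      show "AE p in M. (\<lambda>i. ?q (X i) p) \<longlonglongrightarrow> f' p"
        using der by eventually_elim
          (use X in \<open>auto simp: has_field_derivative_iff tendsto_at_iff_sequentially comp_def\<close>)
      show "AE p in M. norm (?q (X i) p) \<le> w p" for i
        using lip[of "X i"] X by (auto simp: field_simps)
    qed (use meas w in auto)
  qed
  moreover have "(\<integral>p. ?q x p \<partial>M) = ((\<integral>p. f x p \<partial>M) - (\<integral>p. f x0 p \<partial>M)) / (x - x0)" if "x \<in> S" for x
    using int[OF that] int[OF x0] by simp
  ultimately show ?thesis
    unfolding has_field_derivative_iff
    by (rule Lim_transform_within[OF _ zero_less_one]) auto
qed

text \<open>As \<open>k \<ge> 0\<close>, the argument is nondecreasing in the parameter, so the
  slope at the right endpoint \<open>b\<close> dominates all others. Integrability at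
  \<open>b\<close> alone then yields integrability, monotonicity and the derivative on the whole
  interval.\<close>

lemma seclen_integral:
  fixes k l :: "'a \<Rightarrow> real"
  assumes r: "0 < r" and [measurable]: "k \<in> borel_measurable M" "l \<in> borel_measurable M"
    and k: "\<And>p. 0 \<le> k p" and bd: "AE p in M. b * k p + l p < r"
    and w: "integrable M (\<lambda>p. k p * seclen' r (b * k p + l p))"
  shows integrable_seclen': "x \<le> b \<Longrightarrow> integrable M (\<lambda>p. k p * seclen' r (x * k p + l p))"
    and integral_seclen'_mono: "x \<le> y \<Longrightarrow> y \<le> b \<Longrightarrow>
      (\<integral>p. k p * seclen' r (x * k p + l p) \<partial>M) \<le> (\<integral>p. k p * seclen' r (y * k p + l p) \<partial>M)"
    and has_real_derivative_integral_seclen: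
      "(\<And>x. x \<in> {a..b} \<Longrightarrow> integrable M (\<lambda>p. seclen r (x * k p + l p))) \<Longrightarrow>
       AE p in M. k p = 0 \<or> x0 * k p + l p \<noteq> 0 \<Longrightarrow> x0 \<in> {a..b} \<Longrightarrow>
       ((\<lambda>x. \<integral>p. seclen r (x * k p + l p) \<partial>M) has_real_derivative
         (\<integral>p. k p * seclen' r (x0 * k p + l p) \<partial>M)) (at x0 within {a..b})"
proof -
  have mono: "k p * seclen' r (x * k p + l p) \<le> k p * seclen' r (y * k p + l p)"
    if "x \<le> y" "y \<le> b" "b * k p + l p < r" for x y p
    using that k[of p] mult_right_mono[of x y "k p"] mult_right_mono[of y b "k p"]
    by (intro mult_left_mono seclen'_mono[OF r]) auto
  have nonneg: "0 \<le> k p * seclen' r (x * k p + l p)" if "x \<le> b" "b * k p + l p < r" for x p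
    using that k[of p] mult_right_mono[of x b "k p"]
    by (intro mult_nonneg_nonneg seclen'_nonneg[OF r]) auto
  show int: "integrable M (\<lambda>p. k p * seclen' r (x * k p + l p))" if "x \<le> b" for x
  proof (rule Bochner_Integration.integrable_bound[OF w])
    show "AE p in M. norm (k p * seclen' r (x * k p + l p)) \<le> norm (k p * seclen' r (b * k p + l p))"
      using bd by eventually_elim
        (use that mono nonneg in \<open>simp only: real_norm_def abs_of_nonneg order_refl\<close>)
  qed measurable
  show "(\<integral>p. k p * seclen' r (x * k p + l p) \<partial>M) \<le> (\<integral>p. k p * seclen' r (y * k p + l p) \<partial>M)"
    if "x \<le> y" "y \<le> b" for x y
    using bd that by (intro integral_mono_AE int) (auto intro: mono)
  assume i: "\<And>x. x \<in> {a..b} \<Longrightarrow> integrable M (\<lambda>p. seclen r (x * k p + l p))"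
    and nz: "AE p in M. k p = 0 \<or> x0 * k p + l p \<noteq> 0" and x0: "x0 \<in> {a..b}"
  show "((\<lambda>x. \<integral>p. seclen r (x * k p + l p) \<partial>M) has_real_derivative
         (\<integral>p. k p * seclen' r (x0 * k p + l p) \<partial>M)) (at x0 within {a..b})"
  proof (rule has_real_derivative_integral[OF x0 i _ w])
    show "AE p in M. ((\<lambda>x. seclen r (x * k p + l p)) has_real_derivative
        k p * seclen' r (x0 * k p + l p)) (at x0 within {a..b})"
      using bd nz
    proof eventually_elim
      case (elim p)
      show ?case
      proof (cases "k p = 0")
        case False
        have "x0 * k p \<le> b * k p" using x0 k by (intro mult_right_mono) auto
        then have "x0 * k p + l p \<noteq> 0" "x0 * k p + l p < r"
          using False elim by linarith+
        then have "((\<lambda>x. seclen r (x * k p + l p)) has_real_derivative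
            seclen' r (x0 * k p + l p) * k p) (at x0 within {a..b})"
          by (intro DERIV_chain2[where g = "\<lambda>x. x * k p + l p"] DERIV_seclen r)
             (auto intro!: derivative_eq_intros)
        then show ?thesis by (simp add: mult.commute)
      qed simp
    qed
    show "AE p in M. \<bar>seclen r (x * k p + l p) - seclen r (x0 * k p + l p)\<bar>
        \<le> k p * seclen' r (b * k p + l p) * \<bar>x - x0\<bar>" if x: "x \<in> {a..b}" for x
      using bd
    proof eventually_elim
      case (elim p)
      have *: "\<bar>seclen r (y * k p + l p) - seclen r (z * k p + l p)\<bar>
          \<le> k p * seclen' r (b * k p + l p) * (y - z)" if "z \<le> y" "y \<le> b" for y z
      proof -
        have "y * k p + l p < r" "z * k p + l p \<le> y * k p + l p"
          using elim mult_right_mono[of y b "k p"] mult_right_mono[of z y "k p"] k[of p] that by auto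
        from seclen_lipschitz[OF r this(2,1)]
        have "\<bar>seclen r (y * k p + l p) - seclen r (z * k p + l p)\<bar>
          \<le> k p * seclen' r (y * k p + l p) * (y - z)" by (simp add: algebra_simps)
        also have "\<dots> \<le> k p * seclen' r (b * k p + l p) * (y - z)"
          using mono[OF that(2) order_refl elim] that by (intro mult_right_mono) auto
        finally show ?thesis .
      qed
      show ?case using *[of x x0] *[of x0 x] x x0
        by (cases "x \<le> x0") (auto simp: abs_minus_commute)
    qed
  qed measurable
qed

section \<open>The octant region as a superlevel set\<close>

text \<open>Common form of the pieces \<open>Z\<close>, \<open>X\<close> and \<open>Y\<close>;
  \<open>q\<close> stands for their combination of cosines.\<close>

lemma face_iff:
  assumes r: "0 < r" and q: "0 \<le> q" "q \<le> r"
  shows "(pi/2 \<le> u \<and> u \<le> pi/2 + r * arcsin (q / r)) \<longleftrightarrow> pi/2 \<le> u \<and> 0 \<le> q + prof r u"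
  using le_seclen_iff[OF assms, of u] seclen_eq[OF assms] by auto

text \<open>Common form of the three corner pieces: the weights are \<open>1\<close> and
  \<open>1 / \<gamma>\<close>, or twice \<open>\<gamma>\<close>. The upper bounds on
  \<open>u\<close> and \<open>v\<close> follow from the inequality: the terms in \<open>u\<close>
  and \<open>v\<close> are nonpositive and \<open>prof r w \<le> 1\<close>, so each of the two is at
  least \<open>-1\<close>.\<close>

lemma corner_iff:
  assumes r: "0 < r" and p: "0 < p" "1 / p \<le> r" and q: "0 < q" "1 / q \<le> r"
    and \<theta>: "\<theta> = p * r * sin ((u - pi/2) / r) + q * r * sin ((v - pi/2) / r)"
  shows "(pi/2 \<le> u \<and> u \<le> pi/2 + r * arcsin (1 / p / r) \<and>
          pi/2 \<le> v \<and> v \<le> pi/2 + r * arcsin (1 / q / r) \<and>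
          0 \<le> \<theta> \<and> \<theta> \<le> 1 \<and> 0 \<le> w \<and> w \<le> arccos \<theta>) \<longleftrightarrow>
         (pi/2 \<le> u \<and> pi/2 \<le> v \<and> 0 \<le> w \<and> 0 \<le> p * prof r u + q * prof r v + prof r w)"
    (is "?L \<longleftrightarrow> ?R")
proof -
  have iff: "(pi/2 \<le> u \<and> u \<le> pi/2 + r * arcsin (1 / a / r)) \<longleftrightarrow> (pi/2 \<le> u \<and> - 1 \<le> a * prof r u)"
    if "0 < a" "1 / a \<le> r" for a u :: real
    using face_iff[OF r _ that(2), of u] that(1) by (auto simp: field_simps)
  have sin: "r * sin ((u - pi/2) / r) = - prof r u"
    if "0 < a" "1 / a \<le> r" "pi/2 \<le> u" "-1 \<le> a * prof r u" for a u
  proof -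
    have "u \<le> pi/2 + r * arcsin (1 / a / r)"
      using iff[OF that(1,2), of u] that by auto
    moreover have "r * arcsin (1 / a / r) \<le> r * (pi/2)"
      using that r by (intro mult_left_mono arcsin_ubound) (auto simp: field_simps intro: order_trans[of "-1" 0])
    ultimately show ?thesis using prof_ge[OF r that(3)] by linarith
  qed
  have nonpos: "prof r u \<le> 0" if "pi/2 \<le> u" for u
    using prof_le_iff[OF r, of u "pi/2"] that pi_half_ge_zero by (simp add: prof_le[OF r])
  show ?thesis
  proof
    assume L: ?L
    then have uv: "pi/2 \<le> u" "-1 \<le> p * prof r u" "pi/2 \<le> v" "-1 \<le> q * prof r v"
      using iff[OF p, of u] iff[OF q, of v] by auto
    have \<theta>': "\<theta> = - p * prof r u - q * prof r v"
      using sin[OF p uv(1,2)] sin[OF q uv(3,4)] by (simp add: \<theta> mult.assoc)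
    have "arccos \<theta> \<le> pi/2" using L by (intro arccos_le_pi2) auto
    then have "w \<le> pi/2" using L by linarith
    moreover have "cos (arccos \<theta>) \<le> cos w"
      using L \<open>arccos \<theta> \<le> pi/2\<close> by (intro cos_monotone_0_pi_le) auto
    ultimately have "\<theta> \<le> prof r w" using L by (simp add: prof_le[OF r])
    then show ?R using L \<theta>' by auto
  next
    assume R: ?R
    have neg: "p * prof r u \<le> 0" "q * prof r v \<le> 0"
      using R nonpos p q by (auto simp: mult_nonneg_nonpos)
    have w1: "prof r w \<le> 1" using R prof_le_1[OF r] by auto
    have uv: "-1 \<le> p * prof r u" "-1 \<le> q * prof r v" using R neg w1 by auto
    have \<theta>': "\<theta> = - p * prof r u - q * prof r v"
      using sin[OF p _ uv(1)] sin[OF q _ uv(2)] R by (simp add: \<theta> mult.assoc)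
    \<comment> \<open>The other two terms are nonpositive, hence \<open>prof r w \<ge> 0\<close>;
      this keeps \<open>w\<close> where \<open>arccos\<close> inverts \<open>cos\<close>.\<close>
    have w: "w \<le> pi/2" using prof_nonneg_iff[OF r, of w] R neg by auto
    have "0 \<le> \<theta>" "\<theta> \<le> cos w" "\<theta> \<le> 1"
      using \<theta>' neg R w1 prof_le[OF r w] by (simp_all only:) linarith+
    moreover have "arccos (cos w) \<le> arccos \<theta>"
      using calculation by (intro arccos_le_arccos) auto
    then have "w \<le> arccos \<theta>" using w R by (simp add: arccos_cos)
    ultimately show ?L using R uv iff[OF p, of u] iff[OF q, of v] by auto
  qed
qed

lemma Gamma_intD:
  assumes "4 \<le> \<omega>" "\<gamma> \<in> Gamma_int \<omega>"
  shows "2 \<le> sqrt \<omega>" "0 < \<gamma>" "2 * \<gamma> \<le> sqrt \<omega>" "2 / \<gamma> \<le> sqrt \<omega>"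
proof -
  show r: "2 \<le> sqrt \<omega>" using real_sqrt_le_mono[OF assms(1)] by simp
  have g: "2 / sqrt \<omega> \<le> \<gamma>" "\<gamma> \<le> sqrt \<omega> / 2" using assms by (auto simp: Gamma_int_def)
  have "0 < 2 / sqrt \<omega>" using r by (intro divide_pos_pos) linarith+
  then show "0 < \<gamma>" using g by linarith
  then show "2 * \<gamma> \<le> sqrt \<omega>" "2 / \<gamma> \<le> sqrt \<omega>" using g r assms(1) by (auto simp: field_simps)
qed

lemma octant_K_eq:
  assumes "4 \<le> \<omega>" "\<gamma> \<in> Gamma_int \<omega>"
  shows "octant_K \<omega> \<gamma> = {(x, y, z). 0 \<le> x \<and> 0 \<le> y \<and> 0 \<le> z \<and>
           0 \<le> prof (sqrt \<omega>) x + prof (sqrt \<omega>) y + prof (sqrt \<omega>) z / \<gamma>}"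
proof (intro set_eqI, clarify)
  fix x y z :: real
  define r where "r = sqrt \<omega>"
  note G = Gamma_intD[OF assms, folded r_def]
  have r: "0 < r" using G by simp
  have a0: "0 \<le> pi/2" by simp
  have cos01: "0 \<le> cos u" "cos u \<le> 1" "prof r u = cos u" if "0 \<le> u" "u \<le> pi/2" for u
    using that by (auto intro!: cos_ge_zero prof_le[OF r])
  \<comment> \<open>The last bound adds \<open>1 / \<gamma> \<le> r / 2\<close> and
    \<open>1 \<le> r / 2\<close>; it keeps the \<open>arcsin\<close> arguments of
    \<open>piece_X\<close> and \<open>piece_Y\<close> in range.\<close>
  have inv: "1 / \<gamma> \<le> r" "1 \<le> r" "\<gamma> \<le> r" "1 / \<gamma> + 1 \<le> r"
    using G divide_pos_pos[of 1 \<gamma>] by auto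
  have Z: "(x, y, z) \<in> piece_Z \<omega> \<gamma> \<longleftrightarrow> 0 \<le> x \<and> x \<le> pi/2 \<and> 0 \<le> y \<and> y \<le> pi/2 \<and> pi/2 \<le> z \<and>
      0 \<le> prof r x + prof r y + prof r z / \<gamma>"
  proof (cases "0 \<le> x \<and> x \<le> pi/2 \<and> 0 \<le> y \<and> y \<le> pi/2")
    case True
    then have c: "0 \<le> cos x + cos y" "cos x + cos y \<le> 2" "prof r x = cos x" "prof r y = cos y"
      using cos01[of x] cos01[of y] add_mono[OF cos_le_one[of x] cos_le_one[of y]] by auto
    have "\<gamma> * (cos x + cos y) \<le> \<gamma> * 2" using c G by (intro mult_left_mono) auto
    then have q: "0 \<le> \<gamma> * (cos x + cos y)" "\<gamma> * (cos x + cos y) \<le> r"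
      using c G by (simp, linarith)
    have "0 \<le> \<gamma> * (cos x + cos y) + prof r z \<longleftrightarrow> 0 \<le> cos x + cos y + prof r z / \<gamma>"
      using G by (simp add: field_simps)
    then show ?thesis using True c face_iff[OF r q, of z]
      by (auto simp: piece_Z_def r_def)
  qed (auto simp: piece_Z_def)
  have XY: "0 \<le> (\<gamma> * cos y + cos z) / \<gamma>" "(\<gamma> * cos y + cos z) / \<gamma> \<le> r"
    "(\<gamma> * cos y + cos z) / (\<gamma> * r) = (\<gamma> * cos y + cos z) / \<gamma> / r"
    "(\<gamma> * cos y + cos z) / \<gamma> = cos y + cos z / \<gamma>"
    if "0 \<le> y" "y \<le> pi/2" "0 \<le> z" "z \<le> pi/2" for y z
  proof -
    note c = cos01[of y] cos01[of z]
    show eq: "(\<gamma> * cos y + cos z) / \<gamma> = cos y + cos z / \<gamma>" using G by (simp add: field_simps)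
    have "0 \<le> cos z / \<gamma>" "cos z / \<gamma> \<le> 1 / \<gamma>" using c that G by (auto intro: divide_right_mono)
    then show "0 \<le> (\<gamma> * cos y + cos z) / \<gamma>" "(\<gamma> * cos y + cos z) / \<gamma> \<le> r"
      unfolding eq using c that inv cos_le_one[of y] by linarith+
  qed simp
  have X: "(x, y, z) \<in> piece_X \<omega> \<gamma> \<longleftrightarrow> 0 \<le> y \<and> y \<le> pi/2 \<and> 0 \<le> z \<and> z \<le> pi/2 \<and> pi/2 \<le> x \<and>
      0 \<le> prof r x + prof r y + prof r z / \<gamma>"
  proof (cases "0 \<le> y \<and> y \<le> pi/2 \<and> 0 \<le> z \<and> z \<le> pi/2")
    case True
    then show ?thesis using cos01[of y] cos01[of z] XY[of y z] face_iff[OF r XY(1,2), of y z x]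
      by (auto simp: piece_X_def r_def[symmetric])
  qed (auto simp: piece_X_def)
  have Y: "(x, y, z) \<in> piece_Y \<omega> \<gamma> \<longleftrightarrow> 0 \<le> x \<and> x \<le> pi/2 \<and> 0 \<le> z \<and> z \<le> pi/2 \<and> pi/2 \<le> y \<and>
      0 \<le> prof r x + prof r y + prof r z / \<gamma>"
  proof (cases "0 \<le> x \<and> x \<le> pi/2 \<and> 0 \<le> z \<and> z \<le> pi/2")
    case True
    then show ?thesis using cos01[of x] cos01[of z] XY[of x z] face_iff[OF r XY(1,2), of x z y]
      by (auto simp: piece_Y_def r_def[symmetric])
  qed (auto simp: piece_Y_def)
  have ZX: "(x, y, z) \<in> piece_ZX \<omega> \<gamma> \<longleftrightarrow> pi/2 \<le> x \<and> pi/2 \<le> z \<and> 0 \<le> y \<and>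
      0 \<le> prof r x + prof r y + prof r z / \<gamma>"
    using corner_iff[OF r _ _ _ _ refl, of 1 "1 / \<gamma>" x z y] inv G
    by (auto simp: piece_ZX_def r_def[symmetric] Let_def add_ac)
  have YZ: "(x, y, z) \<in> piece_YZ \<omega> \<gamma> \<longleftrightarrow> pi/2 \<le> y \<and> pi/2 \<le> z \<and> 0 \<le> x \<and>
      0 \<le> prof r x + prof r y + prof r z / \<gamma>"
    using corner_iff[OF r _ _ _ _ refl, of 1 "1 / \<gamma>" y z x] inv G
    by (auto simp: piece_YZ_def r_def[symmetric] Let_def add_ac)
  have "0 \<le> \<gamma> * prof r x + \<gamma> * prof r y + prof r z \<longleftrightarrow> 0 \<le> prof r x + prof r y + prof r z / \<gamma>"
    using G by (simp add: field_simps)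
  then have XY: "(x, y, z) \<in> piece_XY \<omega> \<gamma> \<longleftrightarrow> pi/2 \<le> x \<and> pi/2 \<le> y \<and> 0 \<le> z \<and>
      0 \<le> prof r x + prof r y + prof r z / \<gamma>"
    using corner_iff[OF r _ _ _ _ refl, of \<gamma> \<gamma> x y z] inv G
    by (auto simp: piece_XY_def r_def[symmetric] Let_def)
  have C: "(x, y, z) \<in> piece_C \<longleftrightarrow> 0 \<le> x \<and> x \<le> pi/2 \<and> 0 \<le> y \<and> y \<le> pi/2 \<and> 0 \<le> z \<and> z \<le> pi/2 \<and>
      0 \<le> prof r x + prof r y + prof r z / \<gamma>"
    using cos01[of x] cos01[of y] cos01[of z] G by (auto simp: piece_C_def)
  \<comment> \<open>The seven pieces are the seven ways for at most two coordinates to exceed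
    \<open>pi/2\<close>; with all three beyond it, every term would be negative.\<close>
  have nn: "prof r x < 0 \<or> x \<le> pi/2" "prof r y < 0 \<or> y \<le> pi/2" "prof r z / \<gamma> < 0 \<or> z \<le> pi/2"
    if "0 \<le> x" "0 \<le> y" "0 \<le> z"
    using prof_nonneg_iff[OF r, of x] prof_nonneg_iff[OF r, of y] prof_nonneg_iff[OF r, of z] that G
    by (auto simp: divide_less_0_iff)
  show "(x, y, z) \<in> octant_K \<omega> \<gamma> \<longleftrightarrow> (x, y, z) \<in> {(x, y, z). 0 \<le> x \<and> 0 \<le> y \<and> 0 \<le> z \<and>
           0 \<le> prof (sqrt \<omega>) x + prof (sqrt \<omega>) y + prof (sqrt \<omega>) z / \<gamma>}"
    unfolding octant_K_def Un_iff C Z X Y ZX XY YZ r_def[symmetric] mem_Collect_eq prod.case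
    using nn a0 by (smt (verit))
qed

section \<open>Reduction of the volume to an octant integral\<close>

lemma nn_integral_even:
  fixes f :: "real \<Rightarrow> ennreal"
  assumes [measurable]: "f \<in> borel_measurable borel"
  shows "(\<integral>\<^sup>+x. f \<bar>x\<bar> \<partial>lborel) = 2 * (\<integral>\<^sup>+x\<in>{0..}. f x \<partial>lborel)"
proof -
  have "(\<integral>\<^sup>+x. f \<bar>x\<bar> \<partial>lborel) =
      (\<integral>\<^sup>+x. f x * indicator {0..} x + f (- x) * indicator {0..} (- x) \<partial>lborel)"
    \<comment> \<open>The point 0 lies in both half-lines and would be counted twice.\<close>
    by (intro nn_integral_cong_AE, use AE_lborel_singleton[of 0] in eventually_elim)
       (auto split: split_indicator)
  also have "\<dots> = (\<integral>\<^sup>+x\<in>{0..}. f x \<partial>lborel) + (\<integral>\<^sup>+x. f (- x) * indicator {0..} (- x) \<partial>lborel)"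
    by (intro nn_integral_add) auto
  also have "(\<integral>\<^sup>+x. f (- x) * indicator {0..} (- x) \<partial>lborel) = (\<integral>\<^sup>+x\<in>{0..}. f x \<partial>lborel)"
    by (subst nn_integral_real_affine[where c = "-1" and t = 0 and f = "\<lambda>x. f x * indicator {0..} x"]) auto
  finally show ?thesis by (simp add: mult_2)
qed

lemma nn_integral_lborel_pair:
  fixes f :: "'a::euclidean_space \<times> 'b::euclidean_space \<Rightarrow> ennreal"
  assumes "f \<in> borel_measurable borel"
  shows "(\<integral>\<^sup>+p. f p \<partial>lborel) = (\<integral>\<^sup>+x. \<integral>\<^sup>+y. f (x, y) \<partial>lborel \<partial>lborel)"
  unfolding lborel_prod[symmetric]
  by (rule lborel.nn_integral_fst[symmetric]) (use assms in \<open>simp add: lborel_prod\<close>)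

lemma emeasure_symmetric:
  fixes S :: "(real \<times> real \<times> real) set"
  assumes [measurable]: "S \<in> sets borel"
  shows "emeasure lborel {(x, y, z). (\<bar>x\<bar>, \<bar>y\<bar>, \<bar>z\<bar>) \<in> S} =
    8 * (\<integral>\<^sup>+x\<in>{0..}. \<integral>\<^sup>+y\<in>{0..}. \<integral>\<^sup>+z\<in>{0..}. indicator S (x, y, z) \<partial>lborel \<partial>lborel \<partial>lborel)"
proof -
  let ?T = "{(x, y, z). (\<bar>x\<bar>, \<bar>y\<bar>, \<bar>z\<bar>) \<in> S}"
  have [measurable]: "indicator S \<in> borel_measurable (borel \<Otimes>\<^sub>M borel \<Otimes>\<^sub>M borel)"
    by (simp add: borel_prod)
  have T: "?T = (\<lambda>p. (\<bar>fst p\<bar>, \<bar>fst (snd p)\<bar>, \<bar>snd (snd p)\<bar>)) -` S \<inter> space borel" by auto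
  have [measurable]: "?T \<in> sets borel"
    unfolding T by (intro measurable_sets[OF borel_measurable_continuous_onI assms] continuous_intros)
  have [measurable]: "indicator ?T \<in> borel_measurable (borel \<Otimes>\<^sub>M borel \<Otimes>\<^sub>M borel)"
    unfolding borel_prod by measurable
  have i: "indicator ?T (x, y, z) = (indicator S (\<bar>x\<bar>, \<bar>y\<bar>, \<bar>z\<bar>) :: ennreal)" for x y z
    by (auto split: split_indicator)
  have "emeasure lborel ?T = (\<integral>\<^sup>+p. indicator ?T p \<partial>lborel)" by simp
  also have "\<dots> = (\<integral>\<^sup>+x. \<integral>\<^sup>+q. indicator ?T (x, q) \<partial>lborel \<partial>lborel)"
    by (rule nn_integral_lborel_pair) measurable
  also have "\<dots> = (\<integral>\<^sup>+x. \<integral>\<^sup>+y. \<integral>\<^sup>+z. indicator ?T (x, y, z) \<partial>lborel \<partial>lborel \<partial>lborel)"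
    by (intro nn_integral_cong nn_integral_lborel_pair) (simp add: borel_prod[symmetric])
  also have "\<dots> = (\<integral>\<^sup>+x. \<integral>\<^sup>+y. \<integral>\<^sup>+z. indicator S (\<bar>x\<bar>, \<bar>y\<bar>, \<bar>z\<bar>) \<partial>lborel \<partial>lborel \<partial>lborel)"
    by (simp only: i)
  also have "\<dots> = (\<integral>\<^sup>+x. \<integral>\<^sup>+y. 2 * (\<integral>\<^sup>+z\<in>{0..}. indicator S (\<bar>x\<bar>, \<bar>y\<bar>, z) \<partial>lborel) \<partial>lborel \<partial>lborel)"
    by (subst nn_integral_even) measurable
  also have "\<dots> = 2 * (\<integral>\<^sup>+x. \<integral>\<^sup>+y. (\<integral>\<^sup>+z\<in>{0..}. indicator S (\<bar>x\<bar>, \<bar>y\<bar>, z) \<partial>lborel) \<partial>lborel \<partial>lborel)"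
    by (simp add: nn_integral_cmult)
  also have "\<dots> = 2 * (\<integral>\<^sup>+x. 2 * (\<integral>\<^sup>+y\<in>{0..}. \<integral>\<^sup>+z\<in>{0..}. indicator S (\<bar>x\<bar>, y, z) \<partial>lborel \<partial>lborel) \<partial>lborel)"
    by (subst nn_integral_even[where f = "\<lambda>y. \<integral>\<^sup>+z\<in>{0..}. indicator S (\<bar>_\<bar>, y, z) \<partial>lborel"]) measurable
  also have "\<dots> = 4 * (\<integral>\<^sup>+x. (\<integral>\<^sup>+y\<in>{0..}. \<integral>\<^sup>+z\<in>{0..}. indicator S (\<bar>x\<bar>, y, z) \<partial>lborel \<partial>lborel) \<partial>lborel)"
    by (simp add: nn_integral_cmult mult.assoc[symmetric])
  also have "\<dots> = 8 * (\<integral>\<^sup>+x\<in>{0..}. \<integral>\<^sup>+y\<in>{0..}. \<integral>\<^sup>+z\<in>{0..}. indicator S (x, y, z) \<partial>lborel \<partial>lborel \<partial>lborel)"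
  proof -
    have "(\<integral>\<^sup>+x. (\<integral>\<^sup>+y\<in>{0..}. \<integral>\<^sup>+z\<in>{0..}. indicator S (\<bar>x\<bar>, y, z) \<partial>lborel \<partial>lborel) \<partial>lborel) =
        2 * (\<integral>\<^sup>+x\<in>{0..}. \<integral>\<^sup>+y\<in>{0..}. \<integral>\<^sup>+z\<in>{0..}. indicator S (x, y, z) \<partial>lborel \<partial>lborel \<partial>lborel)"
      by (rule nn_integral_even) measurable
    then show ?thesis by (simp add: mult.assoc[symmetric])
  qed
  finally show ?thesis .
qed

text \<open>Needed because \<open>Omega_dom\<close> is an interior: this level set contains the
  frontier of the closed region. A ray from the origin meets it at most once, since moving outward
  strictly decreases every term with a nonzero coordinate.\<close>

lemma negligible_prof_level:
  assumes r: "0 < r" and g: "0 < g"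
  shows "negligible {(x, y, z). prof r \<bar>x\<bar> + prof r \<bar>y\<bar> + prof r \<bar>z\<bar> / g = 0}" (is "negligible ?S")
proof (rule starlike_negligible)
  let ?f = "\<lambda>p. prof r \<bar>fst p\<bar> + prof r \<bar>fst (snd p)\<bar> + prof r \<bar>snd (snd p)\<bar> / g"
  have S: "?S = {p. ?f p = 0}" by auto
  show "closed ?S" unfolding S
    by (intro closed_Collect_eq continuous_intros r) (use g in auto)
  fix c :: real and p :: "real \<times> real \<times> real"
  assume c: "0 + c *\<^sub>R p \<in> ?S" "0 \<le> c" "0 + p \<in> ?S"
  obtain x y z where p: "p = (x, y, z)" by (cases p)
  have c0: "prof r (c * \<bar>x\<bar>) + prof r (c * \<bar>y\<bar>) + prof r (c * \<bar>z\<bar>) / g = 0"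
    using c by (auto simp: p abs_mult)
  have c1: "prof r \<bar>x\<bar> + prof r \<bar>y\<bar> + prof r \<bar>z\<bar> / g = 0"
    using c by (auto simp: p)
  have False if "\<And>u. 0 \<le> u \<Longrightarrow> prof r u \<le> prof r (c * u)" "\<And>u. 0 < u \<Longrightarrow> prof r u < prof r (c * u)"
  proof -
    have "prof r \<bar>z\<bar> / g \<le> prof r (c * \<bar>z\<bar>) / g" "z \<noteq> 0 \<Longrightarrow> prof r \<bar>z\<bar> / g < prof r (c * \<bar>z\<bar>) / g"
      using that[of "\<bar>z\<bar>"] g by (auto intro: divide_right_mono divide_strict_right_mono)
    then have "x = 0 \<and> y = 0 \<and> z = 0"
      using that[of "\<bar>x\<bar>"] that[of "\<bar>y\<bar>"] c0 c1 by (smt (verit))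
    \<comment> \<open>At the origin the sum is \<open>2 + 1 / g\<close>, which is positive.\<close>
    then show False using c1 r g by (simp add: field_simps)
  qed
  moreover have False if "\<And>u. 0 \<le> u \<Longrightarrow> prof r (c * u) \<le> prof r u" "\<And>u. 0 < u \<Longrightarrow> prof r (c * u) < prof r u"
  proof -
    have "prof r (c * \<bar>z\<bar>) / g \<le> prof r \<bar>z\<bar> / g" "z \<noteq> 0 \<Longrightarrow> prof r (c * \<bar>z\<bar>) / g < prof r \<bar>z\<bar> / g"
      using that[of "\<bar>z\<bar>"] g by (auto intro: divide_right_mono divide_strict_right_mono)
    then have "x = 0 \<and> y = 0 \<and> z = 0"
      using that[of "\<bar>x\<bar>"] that[of "\<bar>y\<bar>"] c0 c1 by (smt (verit))
    then show False using c1 r g by (simp add: field_simps)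
  qed
  moreover have "c * u < u \<longleftrightarrow> c < 1" "u < c * u \<longleftrightarrow> 1 < c" if "0 < u" for u
    using that by auto
  ultimately show "c = 1"
    using r \<open>0 \<le> c\<close>
    by (cases c "1::real" rule: linorder_cases)
       (force simp: prof_le_iff prof_less_iff mult_le_cancel_right1 mult_left_le_one_le)+
qed

lemma Vol_eq_nn_integral:
  assumes "4 \<le> \<omega>" "\<gamma> \<in> Gamma_int \<omega>"
  defines "r \<equiv> sqrt \<omega>"
  shows "Vol \<omega> \<gamma> = enn2real (8 * (\<integral>\<^sup>+x\<in>{0..}. \<integral>\<^sup>+y\<in>{0..}. \<integral>\<^sup>+z\<in>{0..}.
    indicator {(x, y, z). 0 \<le> prof r x + prof r y + prof r z / \<gamma>} (x, y, z) \<partial>lborel \<partial>lborel \<partial>lborel))"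
proof -
  note G = Gamma_intD[OF assms(1,2), folded r_def]
  have r: "0 < r" using G by simp
  define K where "K = {(x, y, z). 0 \<le> prof r x + prof r y + prof r z / \<gamma>}"
  define S where "S = {(x, y, z). (\<bar>x\<bar>, \<bar>y\<bar>, \<bar>z\<bar>) \<in> K}"
  have "{(\<sigma>\<^sub>1 * x, \<sigma>\<^sub>2 * y, \<sigma>\<^sub>3 * z) | \<sigma>\<^sub>1 \<sigma>\<^sub>2 \<sigma>\<^sub>3 x y z.
     (x, y, z) \<in> octant_K \<omega> \<gamma> \<and> \<sigma>\<^sub>1 \<in> {-1, 1} \<and> \<sigma>\<^sub>2 \<in> {-1, 1} \<and> \<sigma>\<^sub>3 \<in> {-1, 1}} = S" (is "?R = _")
  proof (intro subset_antisym subsetI)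
    fix p assume "p \<in> S"
    moreover obtain x y z where p: "p = (x, y, z)" by (cases p)
    ultimately have "(\<bar>x\<bar>, \<bar>y\<bar>, \<bar>z\<bar>) \<in> octant_K \<omega> \<gamma>"
      unfolding octant_K_eq[OF assms(1,2)] by (auto simp: S_def K_def r_def)
    moreover have "\<exists>s\<in>{-1,1}. u = s * \<bar>u\<bar>" for u :: real
      by (auto simp: abs_if)
    then obtain s1 s2 s3 where "s1 \<in> {-1,1}" "s2 \<in> {-1,1}" "s3 \<in> {-1,1}"
      "x = s1 * \<bar>x\<bar>" "y = s2 * \<bar>y\<bar>" "z = s3 * \<bar>z\<bar>" by meson
    ultimately show "p \<in> ?R" unfolding p by blast
  qed (auto simp: octant_K_eq[OF assms(1,2)] S_def K_def r_def)
  then have V: "Vol \<omega> \<gamma> = measure lebesgue (interior S)"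
    by (simp add: Vol_def Omega_dom_def)
  have Kc: "K = {p. 0 \<le> prof r (fst p) + prof r (fst (snd p)) + prof r (snd (snd p)) / \<gamma>}"
    by (auto simp: K_def)
  have K: "closed K" unfolding Kc
    by (intro closed_Collect_le continuous_intros r) (use G in auto)
  have Sc: "S = {p. 0 \<le> prof r \<bar>fst p\<bar> + prof r \<bar>fst (snd p)\<bar> + prof r \<bar>snd (snd p)\<bar> / \<gamma>}"
    by (auto simp: S_def K_def)
  have S: "closed S" unfolding Sc
    by (intro closed_Collect_le continuous_intros r) (use G in auto)
  have "{p. 0 < prof r \<bar>fst p\<bar> + prof r \<bar>fst (snd p)\<bar> + prof r \<bar>snd (snd p)\<bar> / \<gamma>} \<subseteq> interior S"
    by (intro interior_maximal open_Collect_less continuous_intros r) (use G in \<open>auto simp: Sc\<close>)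
  then have "frontier S \<subseteq> {(x, y, z). prof r \<bar>x\<bar> + prof r \<bar>y\<bar> + prof r \<bar>z\<bar> / \<gamma> = 0}"
    using S by (force simp: frontier_def Sc)
  then have neg: "negligible (frontier S)"
    using negligible_prof_level[OF r G(2)] negligible_subset by blast
  \<comment> \<open>Leads to boundedness of \<open>S\<close>: two of the three terms are bounded
    above, so the remaining profile value is at least \<open>- r\<close>, the value at the start of
    the linear tail.\<close>
  have bd: "\<bar>u\<bar> \<le> pi/2 + r * (pi/2)" if "- r \<le> prof r \<bar>u\<bar>" for u
  proof -
    have "prof r (pi/2 + r * (pi/2)) = - r" using r by (subst prof_ge) auto
    then show ?thesis using that r prof_le_iff[OF r, of "pi/2 + r * (pi/2)" "\<bar>u\<bar>"] by simp
  qed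
  have "S \<subseteq> cbox (- (pi/2 + r * (pi/2)), - (pi/2 + r * (pi/2)), - (pi/2 + r * (pi/2)))
    (pi/2 + r * (pi/2), pi/2 + r * (pi/2), pi/2 + r * (pi/2))"
  proof
    fix p assume "p \<in> S"
    moreover obtain x y z where p: "p = (x, y, z)" by (cases p)
    ultimately have s: "0 \<le> prof r \<bar>x\<bar> + prof r \<bar>y\<bar> + prof r \<bar>z\<bar> / \<gamma>" by (auto simp: S_def K_def)
    have le1: "prof r \<bar>u\<bar> \<le> 1" for u using prof_le_1[OF r] by simp
    have z: "prof r \<bar>z\<bar> / \<gamma> \<le> 1 / \<gamma>" using le1 G by (intro divide_right_mono) auto
    have "1 + 1 / \<gamma> \<le> r" using G divide_pos_pos[of 1 \<gamma>] by auto
    then have "- r \<le> prof r \<bar>x\<bar>" "- r \<le> prof r \<bar>y\<bar>" using s z le1[of x] le1[of y] by linarith+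
    moreover have "- 2 \<le> prof r \<bar>z\<bar> / \<gamma>" using s le1[of x] le1[of y] by linarith
    then have "- r \<le> prof r \<bar>z\<bar>" using G by (simp add: field_simps)
    ultimately show "p \<in> cbox (- (pi/2 + r * (pi/2)), - (pi/2 + r * (pi/2)), - (pi/2 + r * (pi/2)))
      (pi/2 + r * (pi/2), pi/2 + r * (pi/2), pi/2 + r * (pi/2))"
      using bd[of x] bd[of y] bd[of z] unfolding p cbox_Pair_eq mem_Times_iff by (simp add: abs_le_iff)
  qed
  then have "bounded S" by (rule bounded_subset[OF bounded_cbox])
  then have "Vol \<omega> \<gamma> = measure lebesgue S" using V measure_interior[OF _ neg] by simp
  also have "\<dots> = enn2real (emeasure lborel S)"
    using S by (simp add: measure_completion borel_closed measure_def)
  also have "emeasure lborel S = 8 * (\<integral>\<^sup>+x\<in>{0..}. \<integral>\<^sup>+y\<in>{0..}. \<integral>\<^sup>+z\<in>{0..}. indicator K (x, y, z) \<partial>lborel \<partial>lborel \<partial>lborel)"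
    unfolding S_def using K by (intro emeasure_symmetric borel_closed)
  finally show ?thesis unfolding K_def .
qed

section \<open>Slicing the octant region\<close>

lemma set_nn_integral_swap:
  fixes f :: "real \<times> real \<Rightarrow> ennreal"
  assumes [measurable]: "f \<in> borel_measurable (borel \<Otimes>\<^sub>M borel)" "X \<in> sets borel" "Y \<in> sets borel"
  shows "(\<integral>\<^sup>+x\<in>X. \<integral>\<^sup>+y\<in>Y. f (x, y) \<partial>lborel \<partial>lborel) = (\<integral>\<^sup>+y\<in>Y. \<integral>\<^sup>+x\<in>X. f (x, y) \<partial>lborel \<partial>lborel)"
proof -
  have "(\<integral>\<^sup>+x\<in>X. \<integral>\<^sup>+y\<in>Y. f (x, y) \<partial>lborel \<partial>lborel) =
      (\<integral>\<^sup>+x. \<integral>\<^sup>+y. f (x, y) * indicator Y y * indicator X x \<partial>lborel \<partial>lborel)"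
    by (simp add: nn_integral_multc)
  also have "\<dots> = (\<integral>\<^sup>+y. \<integral>\<^sup>+x. f (x, y) * indicator Y y * indicator X x \<partial>lborel \<partial>lborel)"
    by (rule lborel_pair.Fubini'[symmetric]) measurable
  also have "\<dots> = (\<integral>\<^sup>+y. \<integral>\<^sup>+x. f (x, y) * indicator X x * indicator Y y \<partial>lborel \<partial>lborel)"
    by (simp add: mult_ac)
  also have "\<dots> = (\<integral>\<^sup>+y\<in>Y. \<integral>\<^sup>+x\<in>X. f (x, y) \<partial>lborel \<partial>lborel)"
    by (simp add: nn_integral_multc)
  finally show ?thesis .
qed

lemma set_nn_integral_pair:
  fixes f :: "real \<times> real \<Rightarrow> ennreal"
  assumes [measurable]: "f \<in> borel_measurable (borel \<Otimes>\<^sub>M borel)" "X \<in> sets borel" "Y \<in> sets borel"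
  shows "(\<integral>\<^sup>+x\<in>X. \<integral>\<^sup>+y\<in>Y. f (x, y) \<partial>lborel \<partial>lborel) = (\<integral>\<^sup>+p\<in>X \<times> Y. f p \<partial>lborel)"
proof -
  have "(\<integral>\<^sup>+p\<in>X \<times> Y. f p \<partial>lborel) = (\<integral>\<^sup>+x. \<integral>\<^sup>+y. f (x, y) * indicator (X \<times> Y) (x, y) \<partial>lborel \<partial>lborel)"
    by (rule nn_integral_lborel_pair) (simp add: borel_prod[symmetric])
  also have "\<dots> = (\<integral>\<^sup>+x. \<integral>\<^sup>+y. f (x, y) * indicator Y y * indicator X x \<partial>lborel \<partial>lborel)"
    by (simp add: indicator_times mult_ac)
  finally show ?thesis by (simp add: nn_integral_multc)
qed

text \<open>Cuts one coordinate at \<open>pi/2\<close>: the outer part has an explicit length, the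
  inner part is left to be sliced in another direction.\<close>

lemma set_nn_integral_section:
  assumes "0 < r" "s \<le> r"
  shows "(\<integral>\<^sup>+z\<in>{0..}. indicator {z. 0 \<le> prof r z + s} z \<partial>lborel) =
    ennreal (seclen r s) + (\<integral>\<^sup>+z\<in>{0..pi/2}. indicator {z. 0 \<le> prof r z + s} z \<partial>lborel)"
proof -
  have [measurable]: "{z. 0 \<le> prof r z + s} \<in> sets borel" "{z. pi/2 < z \<and> 0 \<le> prof r z + s} \<in> sets borel"
    by measurable
  have "(\<integral>\<^sup>+z\<in>{0..}. indicator {z. 0 \<le> prof r z + s} z \<partial>lborel) =
    (\<integral>\<^sup>+z. indicator {z. pi/2 < z \<and> 0 \<le> prof r z + s} z +
        indicator {z. 0 \<le> prof r z + s} z * indicator {0..pi/2} z \<partial>lborel)"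
    using pi_gt_zero
    by (intro nn_integral_cong) (auto split: split_indicator simp del: pi_gt_zero)
  also have "\<dots> = ennreal (seclen r s) + (\<integral>\<^sup>+z\<in>{0..pi/2}. indicator {z. 0 \<le> prof r z + s} z \<partial>lborel)"
    by (subst nn_integral_add) (simp_all flip: emeasure_section[OF assms])
  finally show ?thesis .
qed

text \<open>The range beyond \<open>pi/2\<close> is peeled off one coordinate at a time, in the
  order \<open>z\<close>, \<open>y\<close>, \<open>x\<close>; Tonelli brings the coordinate in
  question innermost. Each coordinate already peeled is confined to \<open>{0..pi/2}\<close>
  afterwards, whence the three different domains. The hypotheses on \<open>g\<close> keep all
  arguments of \<open>seclen\<close> at most \<open>r\<close>.\<close>

lemma nn_integral_octant:
  assumes r: "0 < r" and g: "0 < g" "2 * g \<le> r" "1 + 1 / g \<le> r"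
  defines "K \<equiv> {(x, y, z). 0 \<le> prof r x + prof r y + prof r z / g}"
  shows "(\<integral>\<^sup>+x\<in>{0..}. \<integral>\<^sup>+y\<in>{0..}. \<integral>\<^sup>+z\<in>{0..}. indicator K (x, y, z) \<partial>lborel \<partial>lborel \<partial>lborel) =
    (\<integral>\<^sup>+p\<in>{0..}\<times>{0..}. ennreal (seclen r (g * (prof r (fst p) + prof r (snd p)))) \<partial>lborel) +
    ((\<integral>\<^sup>+p\<in>{0..}\<times>{0..pi/2}. ennreal (seclen r (prof r (fst p) + prof r (snd p) / g)) \<partial>lborel) +
     ((\<integral>\<^sup>+p\<in>{0..pi/2}\<times>{0..pi/2}. ennreal (seclen r (prof r (fst p) + prof r (snd p) / g)) \<partial>lborel) +
      ennreal (pi/2) * ennreal (pi/2) * ennreal (pi/2)))"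
proof -
  let ?A = "{0..pi/2}" and ?I = "{0::real..}"
  have "closed K"
  proof -
    have "K = {p. 0 \<le> prof r (fst p) + prof r (fst (snd p)) + prof r (snd (snd p)) / g}"
      by (auto simp: K_def)
    then show ?thesis
      using g by (auto intro!: closed_Collect_le continuous_intros r)
  qed
  then have "indicator K \<in> borel_measurable borel" by (intro borel_measurable_indicator borel_closed)
  then have [measurable]: "indicator K \<in> borel_measurable (borel \<Otimes>\<^sub>M borel \<Otimes>\<^sub>M borel)"
    by (simp add: borel_prod)
  have le1: "prof r x \<le> 1" if "0 \<le> x" for x using prof_le_1[OF r that] .
  have z: "(\<integral>\<^sup>+z\<in>?I. indicator K (x, y, z) \<partial>lborel) =
      ennreal (seclen r (g * (prof r x + prof r y))) + (\<integral>\<^sup>+z\<in>?A. indicator K (x, y, z) \<partial>lborel)"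
    if "0 \<le> x" "0 \<le> y" for x y
  proof -
    have "g * (prof r x + prof r y) \<le> g * 2" using le1[of x] le1[of y] that g by (intro mult_left_mono) auto
    then have s: "g * (prof r x + prof r y) \<le> r" using g by linarith
    have "indicator K (x, y, z) = (indicator {z. 0 \<le> prof r z + g * (prof r x + prof r y)} z :: ennreal)" for z
      using g by (auto simp: K_def indicator_def field_simps)
    then show ?thesis using set_nn_integral_section[OF r s] by simp
  qed
  have le2: "prof r x + prof r z / g \<le> r" if "0 \<le> x" "0 \<le> z" for x z
  proof -
    have "prof r z / g \<le> 1 / g" using le1 that g by (intro divide_right_mono) auto
    then show ?thesis using le1[of x] that g by linarith
  qed
  have y: "(\<integral>\<^sup>+y\<in>?I. indicator K (x, y, z) \<partial>lborel) =
      ennreal (seclen r (prof r x + prof r z / g)) + (\<integral>\<^sup>+y\<in>?A. indicator K (x, y, z) \<partial>lborel)"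
    if "0 \<le> x" "0 \<le> z" for x z
  proof -
    have "indicator K (x, y, z) = (indicator {y. 0 \<le> prof r y + (prof r x + prof r z / g)} y :: ennreal)" for y
      by (auto simp: K_def indicator_def add_ac)
    then show ?thesis using set_nn_integral_section[OF r le2[OF that]] by simp
  qed
  have x: "(\<integral>\<^sup>+x\<in>?I. indicator K (x, y, z) \<partial>lborel) =
      ennreal (seclen r (prof r y + prof r z / g)) + ennreal (pi/2)"
    if "0 \<le> y" "y \<le> pi/2" "0 \<le> z" "z \<le> pi/2" for y z
  proof -
    have "indicator K (x, y, z) = (indicator {x. 0 \<le> prof r x + (prof r y + prof r z / g)} x :: ennreal)" for x
      by (auto simp: K_def indicator_def add_ac)
    \<comment> \<open>With all coordinates at most \<open>pi/2\<close> every term is nonnegative: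
      the cube lies in the region and yields the constant.\<close>
    moreover have "(\<integral>\<^sup>+x\<in>?A. indicator {x. 0 \<le> prof r x + (prof r y + prof r z / g)} x \<partial>lborel) =
        (\<integral>\<^sup>+x. indicator ?A x \<partial>lborel)"
      using that g prof_nonneg_iff[OF r] by (intro nn_integral_cong) (auto split: split_indicator)
    ultimately show ?thesis using set_nn_integral_section[OF r le2, of y z] that by simp
  qed
  have "(\<integral>\<^sup>+x\<in>?I. \<integral>\<^sup>+y\<in>?I. \<integral>\<^sup>+z\<in>?I. indicator K (x, y, z) \<partial>lborel \<partial>lborel \<partial>lborel) =
    (\<integral>\<^sup>+x\<in>?I. \<integral>\<^sup>+y\<in>?I. (ennreal (seclen r (g * (prof r x + prof r y))) +
        (\<integral>\<^sup>+z\<in>?A. indicator K (x, y, z) \<partial>lborel)) \<partial>lborel \<partial>lborel)"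
    by (intro set_nn_integral_cong refl z) auto
  also have "\<dots> = (\<integral>\<^sup>+x\<in>?I. \<integral>\<^sup>+y\<in>?I. ennreal (seclen r (g * (prof r x + prof r y))) \<partial>lborel \<partial>lborel) +
      (\<integral>\<^sup>+x\<in>?I. \<integral>\<^sup>+y\<in>?I. \<integral>\<^sup>+z\<in>?A. indicator K (x, y, z) \<partial>lborel \<partial>lborel \<partial>lborel)"
    by (simp add: distrib_right nn_integral_add)
  also have "(\<integral>\<^sup>+x\<in>?I. \<integral>\<^sup>+y\<in>?I. \<integral>\<^sup>+z\<in>?A. indicator K (x, y, z) \<partial>lborel \<partial>lborel \<partial>lborel) =
      (\<integral>\<^sup>+x\<in>?I. \<integral>\<^sup>+z\<in>?A. \<integral>\<^sup>+y\<in>?I. indicator K (x, y, z) \<partial>lborel \<partial>lborel \<partial>lborel)"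
    by (intro set_nn_integral_cong refl set_nn_integral_swap[where f = "\<lambda>(y, z). indicator K (_, y, z)", simplified])
       measurable
  also have "\<dots> = (\<integral>\<^sup>+x\<in>?I. \<integral>\<^sup>+z\<in>?A. (ennreal (seclen r (prof r x + prof r z / g)) +
        (\<integral>\<^sup>+y\<in>?A. indicator K (x, y, z) \<partial>lborel)) \<partial>lborel \<partial>lborel)"
    by (intro set_nn_integral_cong refl y) auto
  also have "\<dots> = (\<integral>\<^sup>+x\<in>?I. \<integral>\<^sup>+z\<in>?A. ennreal (seclen r (prof r x + prof r z / g)) \<partial>lborel \<partial>lborel) +
      (\<integral>\<^sup>+x\<in>?I. \<integral>\<^sup>+z\<in>?A. \<integral>\<^sup>+y\<in>?A. indicator K (x, y, z) \<partial>lborel \<partial>lborel \<partial>lborel)"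
    by (simp add: distrib_right nn_integral_add)
  also have "(\<integral>\<^sup>+x\<in>?I. \<integral>\<^sup>+z\<in>?A. \<integral>\<^sup>+y\<in>?A. indicator K (x, y, z) \<partial>lborel \<partial>lborel \<partial>lborel) =
      (\<integral>\<^sup>+x\<in>?I. \<integral>\<^sup>+y\<in>?A. \<integral>\<^sup>+z\<in>?A. indicator K (x, y, z) \<partial>lborel \<partial>lborel \<partial>lborel)"
    by (intro set_nn_integral_cong refl set_nn_integral_swap[where f = "\<lambda>(z, y). indicator K (_, y, z)", simplified])
       measurable
  also have "\<dots> = (\<integral>\<^sup>+y\<in>?A. \<integral>\<^sup>+x\<in>?I. \<integral>\<^sup>+z\<in>?A. indicator K (x, y, z) \<partial>lborel \<partial>lborel \<partial>lborel)"
    by (intro set_nn_integral_swap[where f = "\<lambda>(x, y). \<integral>\<^sup>+z\<in>?A. indicator K (x, y, z) \<partial>lborel", simplified])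
       measurable
  also have "\<dots> = (\<integral>\<^sup>+y\<in>?A. \<integral>\<^sup>+z\<in>?A. \<integral>\<^sup>+x\<in>?I. indicator K (x, y, z) \<partial>lborel \<partial>lborel \<partial>lborel)"
    by (intro set_nn_integral_cong refl set_nn_integral_swap[where f = "\<lambda>(x, z). indicator K (x, _, z)", simplified])
       measurable
  also have "\<dots> = (\<integral>\<^sup>+y\<in>?A. \<integral>\<^sup>+z\<in>?A. (ennreal (seclen r (prof r y + prof r z / g)) + ennreal (pi/2)) \<partial>lborel \<partial>lborel)"
    by (intro set_nn_integral_cong refl x) auto
  also have "\<dots> = (\<integral>\<^sup>+y\<in>?A. \<integral>\<^sup>+z\<in>?A. ennreal (seclen r (prof r y + prof r z / g)) \<partial>lborel \<partial>lborel) +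
      ennreal (pi/2) * ennreal (pi/2) * ennreal (pi/2)"
    by (simp add: distrib_right nn_integral_add nn_integral_cmult mult.assoc)
  also have "(\<integral>\<^sup>+y\<in>?A. \<integral>\<^sup>+z\<in>?A. ennreal (seclen r (prof r y + prof r z / g)) \<partial>lborel \<partial>lborel) =
      (\<integral>\<^sup>+p\<in>?A\<times>?A. ennreal (seclen r (prof r (fst p) + prof r (snd p) / g)) \<partial>lborel)"
    by (rule set_nn_integral_pair[where f = "\<lambda>p. ennreal (seclen r (prof r (fst p) + prof r (snd p) / g))", simplified]) measurable
  also have "(\<integral>\<^sup>+x\<in>?I. \<integral>\<^sup>+z\<in>?A. ennreal (seclen r (prof r x + prof r z / g)) \<partial>lborel \<partial>lborel) =
      (\<integral>\<^sup>+p\<in>?I\<times>?A. ennreal (seclen r (prof r (fst p) + prof r (snd p) / g)) \<partial>lborel)"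
    by (rule set_nn_integral_pair[where f = "\<lambda>p. ennreal (seclen r (prof r (fst p) + prof r (snd p) / g))", simplified]) measurable
  also have "(\<integral>\<^sup>+x\<in>?I. \<integral>\<^sup>+y\<in>?I. ennreal (seclen r (g * (prof r x + prof r y))) \<partial>lborel \<partial>lborel) =
      (\<integral>\<^sup>+p\<in>?I\<times>?I. ennreal (seclen r (g * (prof r (fst p) + prof r (snd p)))) \<partial>lborel)"
    by (rule set_nn_integral_pair[where f = "\<lambda>p. ennreal (seclen r (g * (prof r (fst p) + prof r (snd p))))", simplified]) measurable
  finally show ?thesis .
qed

section \<open>Volume formula and the derivative of the lower part\<close>

lemma integrable_lborel_box:
  fixes f :: "'a::euclidean_space \<Rightarrow> real"
  assumes "f \<in> borel_measurable borel" and "\<And>p. \<bar>f p\<bar> \<le> C * indicator (cbox a b) p"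
  shows "integrable lborel f"
proof (rule Bochner_Integration.integrable_bound)
  show "integrable lborel (\<lambda>p. C * indicator (cbox a b) p :: real)"
    using emeasure_lborel_cbox_finite[of a b] by (intro integrable_mult_right integrable_real_indicator) auto
  show "AE p in lborel. norm (f p) \<le> norm (C * indicator (cbox a b) p :: real)"
    using assms(2) by (auto intro: order_trans[OF _ abs_ge_self])
qed (use assms(1) in simp)

lemma integrable_seclen_box:
  fixes s :: "'a::euclidean_space \<Rightarrow> real"
  assumes r: "0 < r" and [measurable]: "s \<in> borel_measurable borel"
    and "\<And>p. p \<notin> cbox a b \<Longrightarrow> s p \<le> 0"
  shows "integrable lborel (\<lambda>p. seclen r (s p))"
  by (rule integrable_lborel_box[where C = "r * (pi/2)" and a = a and b = b])
     (use assms(3) in \<open>auto simp: seclen_nonneg[OF r] seclen_le[OF r, simplified] seclen_nonpos[OF r] indicator_def\<close>)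

text \<open>\<open>kZ\<close> belongs to the slices in direction \<open>z\<close>, with parameter \<open>\<gamma>\<close>; \<open>kW\<close> and \<open>lW\<close> belong to
  the slices of \<open>z \<le> pi/2\<close>, with parameter \<open>1 / \<gamma>\<close>: in direction \<open>y\<close> for \<open>W = {0..}\<close> and in
  direction \<open>x\<close> for \<open>W = {0..pi/2}\<close>.\<close>

definition kZ :: "real \<Rightarrow> real \<times> real \<Rightarrow> real" where
  "kZ r p = indicator ({0..} \<times> {0..}) p * max 0 (prof r (fst p) + prof r (snd p))"

definition kW :: "real \<Rightarrow> real set \<Rightarrow> real \<times> real \<Rightarrow> real" where
  "kW r W p = indicator (W \<times> {0..pi/2}) p * prof r (snd p)"

definition lW :: "real \<Rightarrow> real set \<Rightarrow> real \<times> real \<Rightarrow> real" where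
  "lW r W p = indicator (W \<times> {0..pi/2}) p * prof r (fst p)"

lemma borel_measurable_prof_comp:
  "(\<lambda>p. prof r (fst p)) \<in> borel_measurable (borel :: (real \<times> real) measure)"
  "(\<lambda>p. prof r (snd p)) \<in> borel_measurable (borel :: (real \<times> real) measure)"
  unfolding borel_prod[symmetric] by measurable

lemma borel_measurable_kZ [measurable]: "kZ r \<in> borel_measurable borel"
  unfolding kZ_def[abs_def]
  by (intro borel_measurable_times borel_measurable_max borel_measurable_add borel_measurable_const
      borel_measurable_prof_comp borel_measurable_indicator borel_closed closed_Times) auto

lemma borel_measurable_kW [measurable]:
  assumes "closed W"
  shows "kW r W \<in> borel_measurable borel" "lW r W \<in> borel_measurable borel"
  unfolding kW_def[abs_def] lW_def[abs_def] using assms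
  by (auto intro!: borel_measurable_times borel_measurable_prof_comp borel_measurable_indicator
      borel_closed closed_Times)

lemma kZ_nonneg: "0 \<le> kZ r p" by (simp add: kZ_def)

lemma kW_bounds:
  assumes "0 < r"
  shows "0 \<le> kW r W p" "kW r W p \<le> 1"
proof -
  have "snd p \<le> pi/2 \<Longrightarrow> 0 \<le> snd p \<Longrightarrow> 0 \<le> prof r (snd p) \<and> prof r (snd p) \<le> 1"
    using prof_nonneg_iff[OF assms] prof_le_1[OF assms] by auto
  then show "0 \<le> kW r W p" "kW r W p \<le> 1" by (auto simp: kW_def indicator_def)
qed

lemma lW_le_1: "0 < r \<Longrightarrow> W \<subseteq> {0..} \<Longrightarrow> lW r W p \<le> 1"
  using prof_le_1[of r "fst p"] by (auto simp: lW_def indicator_def)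

section \<open>Bounds and supports of the integrands\<close>

lemma prof_less_neg:
  assumes r: "0 < r" and x: "pi/2 + r * (pi/2) < x"
  shows "prof r x < - r"
proof -
  have "0 \<le> pi/2 + r * (pi/2)" using r by simp
  then have "prof r x < prof r (pi/2 + r * (pi/2))" using prof_strict_antimono[OF r _ x] by simp
  also have "\<dots> = - r" using r by (subst prof_ge) auto
  finally show ?thesis .
qed

lemma kZ_le:
  assumes r: "0 < r"
  shows "kZ r p \<le> 2"
proof -
  have "kZ r (x, y) \<le> 2" for x y
    using prof_le_1[OF r, of x] prof_le_1[OF r, of y] by (auto simp: kZ_def indicator_def)
  then show ?thesis by (cases p) simp
qed

text \<open>At the parameter \<open>r / 2\<close> the argument of \<open>seclen'\<close> therefore
  reaches the singular value \<open>r\<close> at one point only.\<close>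

lemma kZ_less:
  assumes r: "0 < r" and "p \<noteq> 0"
  shows "kZ r p < 2"
proof -
  obtain x y where p: "p = (x, y)" by (cases p)
  then have "x \<noteq> 0 \<or> y \<noteq> 0" using assms(2) by (auto simp: zero_prod_def)
  then consider "x < 0 \<or> y < 0" | "0 < x" "0 \<le> y" | "0 \<le> x" "0 < y" by linarith
  then show ?thesis
  proof cases
    case 1
    then show ?thesis by (auto simp: p kZ_def indicator_def)
  next
    case 2
    then show ?thesis using prof_strict_antimono[OF r, of 0 x] prof_le_1[OF r, of y] r
      by (auto simp: p kZ_def)
  next
    case 3
    then show ?thesis using prof_strict_antimono[OF r, of 0 y] prof_le_1[OF r, of x] r
      by (auto simp: p kZ_def)
  qed
qed

lemma kZ_outside:
  assumes r: "1 \<le> r" and p: "p \<notin> cbox 0 (pi/2 + r * (pi/2), pi/2 + r * (pi/2))"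
  shows "kZ r p = 0"
proof -
  obtain x y where xy: "p = (x, y)" by (cases p)
  have r0: "0 < r" using r by simp
  consider "x < 0 \<or> y < 0" | "0 \<le> x" "0 \<le> y" "pi/2 + r * (pi/2) < x \<or> pi/2 + r * (pi/2) < y"
    using p by (fastforce simp: xy cbox_Pair_eq zero_prod_def)
  then show ?thesis
  proof cases
    case 2
    then have "prof r x + prof r y \<le> 0"
      using prof_less_neg[OF r0, of x] prof_less_neg[OF r0, of y] prof_le_1[OF r0, of x] prof_le_1[OF r0, of y] r
      by linarith
    then show ?thesis by (simp add: kZ_def xy)
  qed (auto simp: kZ_def xy)
qed

text \<open>Outside the box but inside the strip, the profile of the first coordinate is below
  \<open>- r\<close>, while \<open>t \<le> r\<close> bounds the other summand by
  \<open>r\<close>.\<close>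

lemma kW_lW_outside:
  assumes r: "1 \<le> r" and t: "t \<le> r" "0 \<le> t" and W: "W \<subseteq> {0..}"
    and p: "p \<notin> cbox 0 (pi/2 + r * (pi/2), pi/2 + r * (pi/2))"
  shows "t * kW r W p + lW r W p \<le> 0"
proof (cases "p \<in> W \<times> {0..pi/2}")
  case True
  obtain x z where xz: "p = (x, z)" by (cases p)
  have r0: "0 < r" using r by simp
  have z: "0 \<le> z" "z \<le> pi/2" "0 \<le> x" using True W by (auto simp: xz)
  then have "z \<le> pi/2 + r * (pi/2)" using r0 by (intro add_increasing2) auto
  then have "pi/2 + r * (pi/2) < x" using p z by (force simp: xz cbox_Pair_eq zero_prod_def)
  then have "prof r x < - r" by (rule prof_less_neg[OF r0])
  moreover have "t * prof r z \<le> r * 1"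
    using t z prof_le_1[OF r0] prof_nonneg_iff[OF r0] r0 by (intro mult_mono) auto
  ultimately show ?thesis using True by (simp add: kW_def lW_def xz)
qed (simp add: kW_def lW_def)

text \<open>The summand \<open>0\<close> gives the first integrand the affine form of the other two.
  Truncation and indicators may move inside \<open>seclen\<close> because it vanishes at nonpositive
  arguments.\<close>

lemma Vol_eq:
  assumes "4 \<le> \<omega>" "\<gamma> \<in> Gamma_int \<omega>"
  defines "r \<equiv> sqrt \<omega>"
  shows "Vol \<omega> \<gamma> = 8 * ((\<integral>p. seclen r (\<gamma> * kZ r p + 0) \<partial>lborel) +
    ((\<integral>p. seclen r (1 / \<gamma> * kW r {0..} p + lW r {0..} p) \<partial>lborel) +
     ((\<integral>p. seclen r (1 / \<gamma> * kW r {0..pi/2} p + lW r {0..pi/2} p) \<partial>lborel) + pi/2 * (pi/2) * (pi/2))))"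
proof -
  note G = Gamma_intD[OF assms(1,2), folded r_def]
  have r: "0 < r" "1 \<le> r" using G by auto
  have t: "0 \<le> 1 / \<gamma>" "1 / \<gamma> \<le> r" "1 + 1 / \<gamma> \<le> r" using G divide_pos_pos[of 1 \<gamma>] by auto
  let ?Z = "\<lambda>p. seclen r (\<gamma> * kZ r p + 0)" and ?W = "\<lambda>W p. seclen r (1 / \<gamma> * kW r W p + lW r W p)"
  have Z: "(\<integral>\<^sup>+p\<in>{0..}\<times>{0..}. ennreal (seclen r (\<gamma> * (prof r (fst p) + prof r (snd p)))) \<partial>lborel) =
      ennreal (\<integral>p. ?Z p \<partial>lborel)"
  proof -
    have "ennreal (seclen r (\<gamma> * (prof r (fst p) + prof r (snd p)))) * indicator ({0..}\<times>{0..}) p =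
        ennreal (?Z p)" for p
      using G r by (auto simp: kZ_def indicator_def max_def seclen_nonpos mult_nonneg_nonpos)
    moreover have "integrable lborel ?Z"
      by (rule integrable_seclen_box[OF r(1), where a = 0 and b = "(pi/2 + r * (pi/2), pi/2 + r * (pi/2))"])
         (measurable, simp add: kZ_outside[OF r(2), simplified])
    ultimately show ?thesis using seclen_nonneg[OF r(1)] by (simp add: nn_integral_eq_integral)
  qed
  have W: "(\<integral>\<^sup>+p\<in>W\<times>{0..pi/2}. ennreal (seclen r (prof r (fst p) + prof r (snd p) / \<gamma>)) \<partial>lborel) =
      ennreal (\<integral>p. ?W W p \<partial>lborel)" if W: "W \<subseteq> {0..}" "closed W" for W
  proof -
    have [measurable]: "kW r W \<in> borel_measurable borel" "lW r W \<in> borel_measurable borel"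
      using borel_measurable_kW[OF W(2)] by auto
    have "ennreal (seclen r (prof r (fst p) + prof r (snd p) / \<gamma>)) * indicator (W\<times>{0..pi/2}) p =
        ennreal (?W W p)" for p
      using G r by (auto simp: kW_def lW_def indicator_def seclen_nonpos add.commute)
    moreover have "integrable lborel (?W W)"
      by (rule integrable_seclen_box[OF r(1) _ kW_lW_outside[OF r(2) t(2,1) W(1)]]) auto
    ultimately show ?thesis using seclen_nonneg[OF r(1)] by (simp add: nn_integral_eq_integral)
  qed
  have nn: "0 \<le> (\<integral>p. ?Z p \<partial>lborel)" "0 \<le> (\<integral>p. ?W W p \<partial>lborel)" for W
    using seclen_nonneg[OF r(1)] by (auto intro: integral_nonneg_AE)
  show ?thesis
    unfolding Vol_eq_nn_integral[OF assms(1,2), folded r_def] nn_integral_octant[OF r(1) G(2,3) t(3)]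
      Z W[OF order_refl closed_atLeast]
      W[of "{0..pi/2}", OF Icc_subset_Ici_iff[THEN iffD2, OF disjI2[OF order_refl]] closed_atLeastAtMost]
    using nn by (simp flip: ennreal_plus ennreal_mult add: enn2real_mult)
qed

text \<open>As \<open>r > 2\<close>, the argument is at most \<open>r/2 + 1 < r\<close>, so the
  slope is bounded, and it vanishes outside a box; no singularity occurs in these slices.\<close>

lemma has_real_derivative_integral_W:
  assumes r: "2 < r" and W: "W \<subseteq> {0..}" "closed W" and t: "t0 \<in> {2/r..r/2}"
  shows "((\<lambda>t. \<integral>p. seclen r (t * kW r W p + lW r W p) \<partial>lborel) has_real_derivative
      (\<integral>p. kW r W p * seclen' r (t0 * kW r W p + lW r W p) \<partial>lborel)) (at t0 within {2/r..r/2})"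
    and "t \<le> r/2 \<Longrightarrow> integrable lborel (\<lambda>p. kW r W p * seclen' r (t * kW r W p + lW r W p))"
    and "t \<le> t' \<Longrightarrow> t' \<le> r/2 \<Longrightarrow> (\<integral>p. kW r W p * seclen' r (t * kW r W p + lW r W p) \<partial>lborel) \<le>
      (\<integral>p. kW r W p * seclen' r (t' * kW r W p + lW r W p) \<partial>lborel)"
proof -
  have r0: "0 < r" "1 \<le> r" using r by auto
  have [measurable]: "kW r W \<in> borel_measurable borel" "lW r W \<in> borel_measurable borel"
    using borel_measurable_kW[OF W(2)] by auto
  have bd: "r/2 * kW r W p + lW r W p \<le> r/2 + 1" for p
    using lW_le_1[OF r0(1) W(1), of p] mult_left_mono[OF kW_bounds(2)[OF r0(1), of W p], of "r/2"] r
    by linarith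
  have out: "t * kW r W p + lW r W p \<le> 0"
    if "p \<notin> cbox 0 (pi/2 + r * (pi/2), pi/2 + r * (pi/2))" "0 \<le> t" "t \<le> r" for t p
    using kW_lW_outside[OF r0(2) that(3,2) W(1) that(1)] .
  have w: "integrable lborel (\<lambda>p. kW r W p * seclen' r (r/2 * kW r W p + lW r W p))"
  proof (rule integrable_lborel_box[where C = "seclen' r (r/2 + 1)"])
    fix p
    have s: "seclen' r (r/2 * kW r W p + lW r W p) \<le> seclen' r (r/2 + 1)"
      "0 \<le> seclen' r (r/2 * kW r W p + lW r W p)"
      using bd[of p] r by (auto intro!: seclen'_mono seclen'_nonneg)
    show "\<bar>kW r W p * seclen' r (r/2 * kW r W p + lW r W p)\<bar> \<le>
      seclen' r (r/2 + 1) * indicator (cbox 0 (pi/2 + r * (pi/2), pi/2 + r * (pi/2))) p"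
    proof (cases "p \<in> cbox 0 (pi/2 + r * (pi/2), pi/2 + r * (pi/2))")
      case True
      have "kW r W p * seclen' r (r/2 * kW r W p + lW r W p) \<le> 1 * seclen' r (r/2 + 1)"
        using s kW_bounds[OF r0(1), of W p] by (intro mult_mono) auto
      then show ?thesis using True s kW_bounds[OF r0(1), of W p] by (simp add: abs_of_nonneg)
    next
      case False
      then have "r/2 * kW r W p + lW r W p \<le> 0" using r by (intro out) auto
      then show ?thesis using False by (simp add: seclen'_def)
    qed
  qed measurable
  have bd': "AE p in lborel. r/2 * kW r W p + lW r W p < r"
  proof (rule AE_I2)
    show "r/2 * kW r W p + lW r W p < r" for p using bd[of p] r by linarith
  qed
  note * = r0(1) _ _ kW_bounds(1)[OF r0(1)] bd' w
  show "t \<le> r/2 \<Longrightarrow> integrable lborel (\<lambda>p. kW r W p * seclen' r (t * kW r W p + lW r W p))"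
    by (rule integrable_seclen'[OF *]) measurable
  show "t \<le> t' \<Longrightarrow> t' \<le> r/2 \<Longrightarrow> (\<integral>p. kW r W p * seclen' r (t * kW r W p + lW r W p) \<partial>lborel) \<le>
      (\<integral>p. kW r W p * seclen' r (t' * kW r W p + lW r W p) \<partial>lborel)"
    by (rule integral_seclen'_mono[OF *]) measurable
  have t0: "0 < t0" using t r by (auto intro: less_le_trans[of 0 "2/r"])
  have "AE p in lborel \<Otimes>\<^sub>M lborel. kW r W p = 0 \<or> t0 * kW r W p + lW r W p \<noteq> 0"
  proof (rule lborel_pair.AE_pair_measure)
    have "{p \<in> space borel. kW r W p = 0 \<or> t0 * kW r W p + lW r W p \<noteq> 0} \<in> sets borel"
      by measurable
    then show "{p \<in> space (lborel \<Otimes>\<^sub>M lborel). kW r W p = 0 \<or> t0 * kW r W p + lW r W p \<noteq> 0}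
        \<in> sets (lborel \<Otimes>\<^sub>M lborel)"
      by (simp only: lborel_prod space_lborel sets_lborel)
    \<comment> \<open>For fixed \<open>x\<close>, strict monotonicity of the profile lets the
      argument hit the kink for at most one \<open>z\<close> in \<open>{0..pi/2}\<close>.\<close>
    show "AE x in lborel. AE z in lborel. kW r W (x, z) = 0 \<or> t0 * kW r W (x, z) + lW r W (x, z) \<noteq> 0"
    proof (rule AE_I2)
      fix x
      show "AE z in lborel. kW r W (x, z) = 0 \<or> t0 * kW r W (x, z) + lW r W (x, z) \<noteq> 0"
      proof (cases "\<exists>z0\<in>{0..pi/2}. t0 * prof r z0 + prof r x = 0")
        case True
        then obtain z0 where z0: "z0 \<in> {0..pi/2}" "t0 * prof r z0 + prof r x = 0" by blast
        have "z = z0" if "z \<in> {0..pi/2}" "t0 * prof r z + prof r x = 0" for z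
        proof -
          have "t0 * prof r z = t0 * prof r z0" using that z0 by linarith
          then have "prof r z = prof r z0" using t0 by simp
          then show ?thesis
            using that z0 prof_le_iff[OF r0(1), of z z0] prof_le_iff[OF r0(1), of z0 z] by auto
        qed
        then show ?thesis
          using AE_lborel_singleton[of z0] by (elim AE_mp, intro AE_I2) (auto simp: kW_def lW_def indicator_def)
      next
        case False
        then show ?thesis by (intro AE_I2) (auto simp: kW_def lW_def indicator_def)
      qed
    qed
  qed
  then have nz: "AE p in lborel. kW r W p = 0 \<or> t0 * kW r W p + lW r W p \<noteq> 0"
    unfolding lborel_prod .
  show "((\<lambda>t. \<integral>p. seclen r (t * kW r W p + lW r W p) \<partial>lborel) has_real_derivative
      (\<integral>p. kW r W p * seclen' r (t0 * kW r W p + lW r W p) \<partial>lborel)) (at t0 within {2/r..r/2})"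
  proof (rule has_real_derivative_integral_seclen[OF * _ nz t])
    fix t assume "t \<in> {2/r..r/2}"
    moreover have "0 \<le> 2/r" using r by simp
    ultimately have "0 \<le> t" "t \<le> r" using r by (simp_all only: atLeastAtMost_iff) linarith+
    then show "integrable lborel (\<lambda>p. seclen r (t * kW r W p + lW r W p))"
      by (intro integrable_seclen_box[OF r0(1) _ out]) auto
  qed measurable
qed

section \<open>The derivative of the upper part\<close>

text \<open>With \<open>u = x / 2\<close>, \<open>1 - cos x\<close> is twice the square of
  \<open>sin u\<close>; \<open>tan u \<ge> u\<close> gives \<open>sin u \<ge> u * cos u\<close>, and
  the square of \<open>cos u\<close> is at least \<open>1/2\<close> up to
  \<open>pi/4\<close>.\<close>

lemma one_minus_cos_ge:
  assumes "0 \<le> x" "x \<le> pi/2"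
  shows "x\<^sup>2 / 4 \<le> 1 - cos x"
proof -
  define u where "u = x / 2"
  have u: "0 \<le> u" "u \<le> pi/4" using assms by (auto simp: u_def)
  have c: "cos (pi/4) \<le> cos u" using u by (intro cos_monotone_0_pi_le) auto
  then have c0: "0 < cos u" by (rule less_le_trans[rotated]) (simp add: cos_45)
  have "u < pi/2" using u pi_gt_zero by linarith
  then have "u \<le> tan u" using abs_tan_ge[of u] u tan_pos_pi2_le[of u] by simp
  then have "u * cos u \<le> sin u" using c0 by (simp add: tan_def field_simps)
  then have "(u * cos u)\<^sup>2 \<le> (sin u)\<^sup>2" using u c0 by (intro power_mono) auto
  moreover have "(cos (pi/4))\<^sup>2 \<le> (cos u)\<^sup>2" using c by (intro power_mono) (auto simp: cos_45)
  then have "1/2 \<le> (cos u)\<^sup>2" by (simp add: cos_45 power_divide)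
  then have "u\<^sup>2 * (1/2) \<le> u\<^sup>2 * (cos u)\<^sup>2" by (intro mult_left_mono) auto
  ultimately have "u\<^sup>2 \<le> 2 * (sin u)\<^sup>2" by (simp add: power_mult_distrib)
  also have "\<dots> = 1 - cos x" using cos_double_sin[of u] by (simp add: u_def)
  finally show ?thesis by (simp add: u_def power_divide)
qed

text \<open>Extends the quadratic bound at 0 to the whole support, whose side length will be
  \<open>b\<close>: beyond \<open>pi/2\<close> the left side is at most 1 and the right side at
  least 1.\<close>

lemma one_minus_prof_ge:
  assumes r: "1 \<le> r" and x: "0 \<le> x" "x \<le> b" and b: "2 \<le> b"
  shows "(x / b)\<^sup>2 \<le> 1 - prof r x"
proof (cases "x \<le> pi/2")
  case True
  have "(x / b)\<^sup>2 \<le> (x / 2)\<^sup>2" using x b by (intro power_mono divide_left_mono) auto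
  also have "\<dots> \<le> 1 - cos x" using one_minus_cos_ge[OF x(1) True] by (simp add: power_divide)
  finally show ?thesis using True r by (simp add: prof_le)
next
  case False
  then have "prof r x \<le> 0" using prof_nonneg_iff[of r x] x r by auto
  moreover have "(x / b)\<^sup>2 \<le> 1" using x b by (intro power_le_one) auto
  ultimately show ?thesis by linarith
qed

lemma integrable_inv_sqrt: "integrable lborel (\<lambda>x::real. indicator {0<..b} x * x powr (-1/2))"
proof (cases "0 \<le> b")
  case True
  have "(\<lambda>x. x powr (-1/2)) absolutely_integrable_on {0<..b}"
    using integrable_on_powr_from_0'[of "-1/2" b] True
    by (subst absolutely_integrable_on_iff_nonneg) auto
  then have "integrable lebesgue (\<lambda>x::real. indicator {0<..b} x * x powr (-1/2))"
    by (simp add: set_integrable_def)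
  then show ?thesis by (subst (asm) integrable_completion) auto
qed simp

lemma integrable_product_lborel:
  fixes u v :: "real \<Rightarrow> real"
  assumes "integrable lborel u" "integrable lborel v"
  shows "integrable lborel (\<lambda>p. u (fst p) * v (snd p))"
proof -
  have [measurable]: "u \<in> borel_measurable borel" "v \<in> borel_measurable borel"
    using assms by auto
  have "integrable (lborel \<Otimes>\<^sub>M lborel) (\<lambda>p. u (fst p) * v (snd p))"
    using assms by (intro lborel_pair.Fubini_integrable) (auto simp: abs_mult)
  then show ?thesis by (simp add: lborel_prod)
qed

text \<open>At \<open>\<gamma> = r / 2\<close> the integrand blows up at the origin only; by AM-GM, \<open>1 - k / 2\<close> is at least
  a multiple of \<open>x y\<close>, and \<open>1 / sqrt (x y)\<close> is integrable.\<close>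

lemma integrable_kZ_seclen':
  assumes r: "1 \<le> r"
  shows "integrable lborel (\<lambda>p. kZ r p * seclen' r (r/2 * kZ r p + 0))"
proof (rule Bochner_Integration.integrable_bound)
  define b where "b = pi/2 + r * (pi/2)"
  have r0: "0 < r" using r by simp
  have b: "2 \<le> b" using mult_right_mono[OF r, of "pi/2"] pi_ge_two unfolding b_def by linarith
  let ?u = "\<lambda>x::real. indicator {0<..b} x * x powr (-1/2)"
  show "integrable lborel (\<lambda>p. (2 * b) * (?u (fst p) * ?u (snd p)))"
    by (intro integrable_mult_right integrable_product_lborel integrable_inv_sqrt)
  \<comment> \<open>On the axes the majorant is 0 because its indicators exclude 0, so the bound is
    claimed off them.\<close>
  have null: "AE p in lborel. fst p \<noteq> (0::real) \<and> snd p \<noteq> (0::real)"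
  proof -
    have "AE p in lborel \<Otimes>\<^sub>M lborel. fst p \<noteq> (0::real) \<and> snd p \<noteq> (0::real)"
    proof (rule lborel_pair.AE_pair_measure)
      show "AE x in lborel. AE y in lborel. fst (x, y) \<noteq> (0::real) \<and> snd (x, y) \<noteq> (0::real)"
        using AE_lborel_singleton[of "0::real"]
      proof eventually_elim
        case (elim x)
        then show ?case using AE_lborel_singleton[of "0::real"] by simp
      qed
    qed measurable
    then show ?thesis unfolding lborel_prod .
  qed
  show "AE p in lborel. norm (kZ r p * seclen' r (r/2 * kZ r p + 0)) \<le>
      norm ((2 * b) * (?u (fst p) * ?u (snd p)))"
    using null
  proof (rule AE_mp, intro AE_I2 impI)
    fix p :: "real \<times> real" assume ne: "fst p \<noteq> 0 \<and> snd p \<noteq> 0"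
    obtain x y where p: "p = (x, y)" by (cases p)
    define k where "k = kZ r p"
    show "norm (kZ r p * seclen' r (r/2 * kZ r p + 0)) \<le> norm ((2 * b) * (?u (fst p) * ?u (snd p)))"
    proof (cases "k = 0")
      case False
      then have k: "0 < k" "k \<le> 2" using kZ_nonneg[of r p] kZ_le[OF r0, of p] by (auto simp: k_def)
      have "p \<in> cbox 0 (b, b)" using False kZ_outside[OF r, of p] by (auto simp: k_def b_def)
      then have xy: "0 < x" "x \<le> b" "0 < y" "y \<le> b" using ne by (auto simp: p cbox_Pair_eq zero_prod_def)
      have k_eq: "k = prof r x + prof r y" using k xy by (auto simp: k_def kZ_def p max_def split: if_splits)
      \<comment> \<open>Replaces the square under the root by \<open>k / 2\<close>, to which the
        quadratic bounds on the profiles apply directly.\<close>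
      have "(k/2)\<^sup>2 \<le> k/2" using k mult_right_mono[of "k/2" 1 "k/2"] by (simp add: power2_eq_square)
      moreover have "(x/b)\<^sup>2 + (y/b)\<^sup>2 \<le> 2 - k"
        using one_minus_prof_ge[OF r, of x b] one_minus_prof_ge[OF r, of y b] xy b by (simp add: k_eq)
      moreover have "2 * (x/b) * (y/b) \<le> (x/b)\<^sup>2 + (y/b)\<^sup>2" by (rule sum_squares_bound)
      ultimately have q: "x / b * (y / b) \<le> 1 - (k/2)\<^sup>2" by linarith
      have pos: "0 < x / b * (y / b)" using xy b by simp
      have "seclen' r (r/2 * k) = 1 / sqrt (1 - (k/2)\<^sup>2)" using k r by (simp add: seclen'_def)
      also have "\<dots> \<le> 1 / sqrt (x / b * (y / b))"
        using q pos by (intro divide_left_mono) auto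
      also have "\<dots> = b * (x powr (-1/2) * y powr (-1/2))"
        using xy b by (simp add: real_sqrt_mult real_sqrt_divide powr_minus powr_half_sqrt field_simps)
      finally have "seclen' r (r/2 * k) \<le> b * (x powr (-1/2) * y powr (-1/2))" .
      moreover have "0 \<le> seclen' r (r/2 * k)"
        using q pos k r by (simp add: seclen'_def)
      moreover from calculation have "k * seclen' r (r/2 * k) \<le> 2 * (b * (x powr (-1/2) * y powr (-1/2)))"
        using k by (intro mult_mono) auto
      ultimately show ?thesis using k xy b by (simp add: p[symmetric] k_def[symmetric]) (simp add: p)
    qed (simp add: k_def)
  qed
qed measurable

lemma has_real_derivative_integral_Z:
  assumes r: "1 \<le> r" and t: "t0 \<in> {2/r..r/2}"
  shows "((\<lambda>t. \<integral>p. seclen r (t * kZ r p + 0) \<partial>lborel) has_real_derivative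
      (\<integral>p. kZ r p * seclen' r (t0 * kZ r p + 0) \<partial>lborel)) (at t0 within {2/r..r/2})"
    and "t \<le> r/2 \<Longrightarrow> integrable lborel (\<lambda>p. kZ r p * seclen' r (t * kZ r p + 0))"
    and "t \<le> t' \<Longrightarrow> t' \<le> r/2 \<Longrightarrow> (\<integral>p. kZ r p * seclen' r (t * kZ r p + 0) \<partial>lborel) \<le>
      (\<integral>p. kZ r p * seclen' r (t' * kZ r p + 0) \<partial>lborel)"
proof -
  have r0: "0 < r" using r by simp
  have bd: "AE p in lborel. r/2 * kZ r p + 0 < r"
    using AE_lborel_singleton[of "0::real\<times>real"]
  proof (rule AE_mp, intro AE_I2 impI)
    fix p :: "real \<times> real" assume "p \<noteq> 0"
    then show "r/2 * kZ r p + 0 < r" using kZ_less[OF r0, of p] r by simp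
  qed
  note * = r0 _ _ kZ_nonneg bd integrable_kZ_seclen'[OF r]
  show "t \<le> r/2 \<Longrightarrow> integrable lborel (\<lambda>p. kZ r p * seclen' r (t * kZ r p + 0))"
    by (rule integrable_seclen'[OF *]) measurable
  show "t \<le> t' \<Longrightarrow> t' \<le> r/2 \<Longrightarrow> (\<integral>p. kZ r p * seclen' r (t * kZ r p + 0) \<partial>lborel) \<le>
      (\<integral>p. kZ r p * seclen' r (t' * kZ r p + 0) \<partial>lborel)"
    by (rule integral_seclen'_mono[OF *]) measurable
  have t0: "0 < t0" using t r by (auto intro: less_le_trans[of 0 "2/r"])
  show "((\<lambda>t. \<integral>p. seclen r (t * kZ r p + 0) \<partial>lborel) has_real_derivative
      (\<integral>p. kZ r p * seclen' r (t0 * kZ r p + 0) \<partial>lborel)) (at t0 within {2/r..r/2})"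
  proof (rule has_real_derivative_integral_seclen[OF * _ _ t])
    show "integrable lborel (\<lambda>p. seclen r (t * kZ r p + 0))" for t
      by (rule integrable_seclen_box[OF r0, where a = 0 and b = "(pi/2 + r * (pi/2), pi/2 + r * (pi/2))"])
         (measurable, simp add: kZ_outside[OF r, simplified])
    \<comment> \<open>Without an offset and with \<open>t0 > 0\<close>, the argument reaches the
      kink only where \<open>kZ\<close> itself vanishes.\<close>
    show "AE p in lborel. kZ r p = 0 \<or> t0 * kZ r p + 0 \<noteq> 0" using t0 by auto
  qed measurable
qed

section \<open>Balance of the derivatives at 1\<close>

text \<open>Substituting \<open>u = - prof r x\<close>, the integrand becomes
  \<open>(m - 2 u) / sqrt ((1 - u\<^sup>2 / r\<^sup>2) (1 - (m - u)\<^sup>2 / r\<^sup>2))\<close>, which is odd under \<open>u \<mapsto> m - u\<close>.\<close>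

lemma integral_prof_odd:
  assumes r: "1 < r" and m: "0 \<le> m" "m \<le> 1"
  shows "(\<integral>x. indicator {pi/2<..} x * ((2 * prof r x + m) * seclen' r (prof r x + m)) \<partial>lborel) = 0"
    (is "integral\<^sup>L lborel ?F = 0")
\<comment> \<open>In the other case the Bochner integral is 0 by convention.\<close>
proof (cases "integrable lborel ?F")
  case True
  have r0: "0 < r" using r by simp
  define \<phi> where "\<phi> u = 1 / sqrt (1 - (u/r)\<^sup>2)" for u
  define f where "f x = (2 * prof r x + m) * \<phi> (prof r x + m)" for x
  \<comment> \<open>The substitution \<open>x = g u\<close> inverts \<open>u = - prof r x\<close>,
    and its derivative is \<open>\<phi> u\<close>.\<close>
  define g where "g u = pi/2 + r * arcsin (u/r)" for u
  have sq: "(u/r)\<^sup>2 < 1" if "\<bar>u\<bar> < r" for u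
    using that r0 by (simp add: abs_square_less_1)
  have g: "g u = pi/2 + seclen r u" "prof r (g u) = - u" "pi/2 \<le> g u" if "0 \<le> u" "u \<le> m" for u
    using that m r prof_seclen[OF r0, of u] seclen_eq[OF r0, of u] seclen_nonneg[OF r0, of u]
    by (auto simp: g_def)
  have pg: "- m \<le> prof r x" "prof r x \<le> 0" if "x \<in> {pi/2..g m}" for x
  proof -
    have "pi/2 \<le> x" using that by simp
    then have "0 \<le> x" using pi_half_ge_zero by linarith
    then show "- m \<le> prof r x" "prof r x \<le> 0"
      using that prof_le_iff[OF r0, of "g m" x] prof_le_iff[OF r0, of x "pi/2"] g[of m] m prof_le[OF r0, of "pi/2"]
        pi_half_ge_zero by (auto intro: order_trans)
  qed
  have gmono: "g u \<le> g m" if "0 \<le> u" "u \<le> m" for u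
    unfolding g_def using that m r
    by (intro add_left_mono mult_left_mono arcsin_le_arcsin divide_right_mono) (auto intro: order_trans[of _ 0])
  have "((\<lambda>u. \<phi> u *\<^sub>R f (g u)) has_integral integral {g 0..g m} f) {0..m}"
  proof (rule has_integral_substitution[where c = "pi/2" and d = "g m"])
    show "g ` {0..m} \<subseteq> {pi/2..g m}" using g(3) gmono by auto
    show "g 0 \<le> g m" using gmono m by simp
    show "continuous_on {pi/2..g m} f"
      unfolding f_def \<phi>_def
    proof (intro continuous_intros r0 ballI)
      fix x assume "x \<in> {pi/2..g m}"
      then have "((prof r x + m)/r)\<^sup>2 < 1" using pg[of x] m r by (intro sq) auto
      then show "sqrt (1 - ((prof r x + m)/r)\<^sup>2) \<noteq> 0" by simp
    qed (use r in auto)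
    fix u assume "u \<in> {0..m}"
    then have "\<bar>u\<bar> < r" using m r by auto
    then show "(g has_real_derivative \<phi> u) (at u within {0..m})"
      unfolding g_def[abs_def] \<phi>_def using r0
      by (auto intro!: derivative_eq_intros simp: divide_simps)
  qed (use m in auto)
  moreover define h where "h u = \<phi> u * ((m - 2 * u) * \<phi> (m - u))" for u
  ultimately have h: "(h has_integral integral {g 0..g m} f) {0..m}"
    using g by (elim has_integral_eq[rotated]) (auto simp: h_def f_def add.commute)
  \<comment> \<open>Reflection of \<open>{0..m}\<close> at its midpoint: it preserves the integral
    and negates \<open>h\<close>.\<close>
  have "((\<lambda>u. h (-1 * u + m)) has_integral (1 / \<bar>- 1\<bar> ^ DIM(real)) *\<^sub>R integral {g 0..g m} f)
      ((\<lambda>u. (1 / - 1) *\<^sub>R u + - ((1 / - 1) *\<^sub>R m)) ` cbox 0 m)"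
    using has_integral_affinity[of h _ 0 m "-1" m] h by simp
  moreover have "(\<lambda>u. (1 / - 1) *\<^sub>R u + - ((1 / - 1) *\<^sub>R m)) ` cbox 0 m = {0..m}"
    using image_affinity_atLeastAtMost[of "-1" m 0 m] m by simp
  moreover have "h (-1 * u + m) = - h u" for u
    by (simp add: h_def algebra_simps)
  ultimately have "((\<lambda>u. - h u) has_integral integral {g 0..g m} f) {0..m}" by simp
  then have "integral {g 0..g m} f = - integral {g 0..g m} f"
    using has_integral_neg[OF h] has_integral_unique by blast
  then have 0: "integral {pi/2..g m} f = 0" by (simp add: g_def)
  have "integral\<^sup>L lborel ?F = integral UNIV ?F"
    using integral_lborel[OF True] by simp
  also have "\<dots> = integral UNIV (\<lambda>x. if x \<in> {pi/2..g m} then f x else 0)"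
  \<comment> \<open>Beyond \<open>g m\<close> the argument is negative and \<open>seclen'\<close>
    vanishes. The two endpoints are excepted: the open indicator drops \<open>pi/2\<close>, and at
    \<open>g m\<close> the argument is 0, where \<open>seclen'\<close> is 0 but
    \<open>\<phi>\<close> is 1.\<close>
  proof (rule integral_spike[of "{pi/2, g m}"])
    fix x assume x: "x \<in> UNIV - {pi/2, g m}"
    consider "x < pi/2" | "x \<in> {pi/2..g m}" "pi/2 < x" "x < g m" | "g m < x" "pi/2 < x"
      using x g[of m] m by fastforce
    then show "(if x \<in> {pi/2..g m} then f x else 0) = ?F x"
    proof cases
      case 2
      then have "0 \<le> x" using pi_half_ge_zero by linarith
      then have "prof r (g m) < prof r x" using 2 by (intro prof_strict_antimono r0)
      then have "0 < prof r x + m" using g[of m] m by simp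
      then show ?thesis using 2 by (auto simp: f_def \<phi>_def seclen'_def)
    next
      case 3
      have "pi/2 \<le> g m" using g[of m] m by simp
      then have "0 \<le> g m" using pi_half_ge_zero by linarith
      then have "prof r x < prof r (g m)" using 3 by (intro prof_strict_antimono r0)
      then have "prof r x + m < 0" using g[of m] m by simp
      then show ?thesis using 3 by (auto simp: seclen'_def)
    qed (auto)
  qed auto
  also have "\<dots> = 0" using 0 unfolding integral_restrict_UNIV .
  finally show ?thesis .
qed (simp add: not_integrable_integral_eq)

lemma integral_swap_lborel:
  fixes h :: "real \<times> real \<Rightarrow> real"
  assumes "integrable lborel h"
  shows "integrable lborel (\<lambda>p. h (snd p, fst p))" "(\<integral>p. h (snd p, fst p) \<partial>lborel) = integral\<^sup>L lborel h"
  using lborel_pair.integrable_product_swap[of h] lborel_pair.integral_product_swap[of h] assms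
  by (auto simp: lborel_prod case_prod_unfold)

text \<open>Cut at \<open>pi/2\<close>. On the square of small coordinates, the left integrand is
  the last one plus its mirror image. Off the square it contributes \<open>u\<close> and its mirror
  image, and the middle integrand contributes \<open>v\<close>. It remains to see that the integral
  of \<open>2 * u - v\<close> is 0, and for each fixed \<open>z\<close> this is
  \<open>integral_prof_odd\<close> with \<open>m = prof r z\<close>.\<close>

lemma derivative_balance:
  assumes r: "2 < r"
  shows "(\<integral>p. kZ r p * seclen' r (1 * kZ r p + 0) \<partial>lborel) =
    (\<integral>p. kW r {0..} p * seclen' r (1 * kW r {0..} p + lW r {0..} p) \<partial>lborel) +
    (\<integral>p. kW r {0..pi/2} p * seclen' r (1 * kW r {0..pi/2} p + lW r {0..pi/2} p) \<partial>lborel)"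
    (is "integral\<^sup>L _ ?Z = integral\<^sup>L _ ?I + integral\<^sup>L _ ?A")
proof -
  have r0: "0 < r" "1 < r" "1 \<le> r" "1 \<le> r/2" using r by auto
  let ?P = "indicator ({pi/2<..} \<times> {0..pi/2}) :: real \<times> real \<Rightarrow> real"
  define \<Psi> where "\<Psi> p = seclen' r (prof r (fst p) + prof r (snd p))" for p :: "real \<times> real"
  define u where "u p = ?P p * ((prof r (fst p) + prof r (snd p)) * \<Psi> p)" for p
  define v where "v p = ?P p * (prof r (snd p) * \<Psi> p)" for p
  have I: "integrable lborel ?I" "integrable lborel ?A"
    using has_real_derivative_integral_W(2)[OF r, of "{0..}" 1 1]
      has_real_derivative_integral_W(2)[OF r, of "{0..pi/2}" 1 1] r0 by auto
  have [measurable]: "(\<lambda>p. prof r (fst p)) \<in> borel_measurable (borel :: (real \<times> real) measure)"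
    "(\<lambda>p. prof r (snd p)) \<in> borel_measurable (borel :: (real \<times> real) measure)"
    by (rule borel_measurable_prof_comp)+
  have [measurable]: "?P \<in> borel_measurable borel"
    by (intro borel_measurable_indicator) (simp add: borel_prod[symmetric])
  have [measurable]: "\<Psi> \<in> borel_measurable borel" unfolding \<Psi>_def[abs_def] by measurable
  have v: "integrable lborel v"
  proof (rule Bochner_Integration.integrable_bound[OF I(1)])
    show "AE p in lborel. norm (v p) \<le> norm (?I p)"
      using pi_half_ge_zero by (intro AE_I2) (auto simp: v_def \<Psi>_def kW_def lW_def indicator_def add.commute)
  qed (unfold v_def[abs_def], measurable)
  have u: "integrable lborel u"
  proof (rule Bochner_Integration.integrable_bound[OF v])
    \<comment> \<open>Where the slope is nonzero, the sum of the profiles is positive, and it is at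
      most the second profile because the first one is nonpositive.\<close>
    show "AE p in lborel. norm (u p) \<le> norm (v p)"
    proof (rule AE_I2)
      fix p :: "real \<times> real"
      show "norm (u p) \<le> norm (v p)"
      proof (cases "p \<in> {pi/2<..} \<times> {0..pi/2} \<and> 0 < prof r (fst p) + prof r (snd p)")
        case True
        then have "prof r (fst p) \<le> 0"
          using prof_nonneg_iff[OF r0(1), of "fst p"] pi_half_ge_zero by (auto simp: mem_Times_iff)
        then show ?thesis using True by (auto simp: u_def v_def abs_mult intro!: mult_right_mono)
      qed (auto simp: u_def v_def \<Psi>_def seclen'_def)
    qed
  qed (unfold u_def[abs_def], measurable)
  have uv: "(\<integral>p. 2 * u p - v p \<partial>lborel) = 0"
  proof -
    have i: "integrable (lborel \<Otimes>\<^sub>M lborel) (\<lambda>(x, z). 2 * u (x, z) - v (x, z))"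
      using u v by (simp add: lborel_prod case_prod_unfold)
    have "(\<integral>x. 2 * u (x, z) - v (x, z) \<partial>lborel) = 0" for z
    proof (cases "z \<in> {0..pi/2}")
      case True
      then have m: "0 \<le> prof r z" "prof r z \<le> 1" using prof_nonneg_iff[OF r0(1)] prof_le_1[OF r0(1)] by auto
      have "2 * u (x, z) - v (x, z) =
          indicator {pi/2<..} x * ((2 * prof r x + prof r z) * seclen' r (prof r x + prof r z))" for x
        using True by (simp add: u_def v_def \<Psi>_def indicator_times algebra_simps)
      then show ?thesis using integral_prof_odd[OF r0(2) m] by simp
    qed (simp add: u_def v_def)
    then have "(\<integral>z. (\<integral>x. 2 * u (x, z) - v (x, z) \<partial>lborel) \<partial>lborel) = 0" by simp
    then show ?thesis
      using lborel_pair.integral_snd[OF i] by (simp add: lborel_prod case_prod_unfold)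
  qed
  have Z: "?Z p = ?A p + ?A (snd p, fst p) + u p + u (snd p, fst p)" for p
  proof -
    obtain x y where p: "p = (x, y)" by (cases p)
    have n: "prof r x < 0" if "pi/2 < x" for x
      using prof_nonneg_iff[OF r0(1), of x] that pi_half_ge_zero by linarith
    have q: "0 \<le> prof r x" if "0 \<le> x" "x \<le> pi/2" for x
      using prof_nonneg_iff[OF r0(1), of x] that by linarith
    have s: "max 0 a * seclen' r (max 0 a) = a * seclen' r a" for a
      by (simp add: max_def seclen'_def)
    show ?thesis
    proof (cases "0 \<le> x \<and> 0 \<le> y")
      case True
      then have "?Z p = (prof r x + prof r y) * seclen' r (prof r x + prof r y)"
        using s by (simp add: kZ_def p)
      moreover have "seclen' r (prof r x + prof r y) = 0" if "pi/2 < x" "pi/2 < y"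
        using n[OF that(1)] n[OF that(2)] by (simp add: seclen'_def)
      ultimately show ?thesis using True
        by (cases "x \<le> pi/2"; cases "y \<le> pi/2")
           (auto simp: p kW_def lW_def u_def \<Psi>_def indicator_def algebra_simps)
    next
      case False
      then show ?thesis using pi_half_ge_zero by (auto simp: p kZ_def kW_def u_def indicator_def)
    qed
  qed
  have Ieq: "?I p = ?A p + v p" for p
    using pi_half_ge_zero
    by (cases "fst p \<le> pi/2") (auto simp: kW_def lW_def v_def \<Psi>_def indicator_def add.commute mem_Times_iff)
  note sw = integral_swap_lborel[OF I(2)] integral_swap_lborel[OF u]
  have "integral\<^sup>L lborel ?Z = 2 * integral\<^sup>L lborel ?A + 2 * integral\<^sup>L lborel u"
    unfolding Z using I(2) u sw by simp
  moreover have "integral\<^sup>L lborel ?I = integral\<^sup>L lborel ?A + integral\<^sup>L lborel v"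
    unfolding Ieq using I(2) v by simp
  moreover have "2 * integral\<^sup>L lborel u = integral\<^sup>L lborel v"
    using uv u v by simp
  ultimately show ?thesis by linarith
qed

section \<open>Sign of the derivative\<close>

text \<open>Lower bound on a small square near the origin: both profiles are at least
  \<open>cos (1/2)\<close> there, and the slope is at least 1 wherever its argument is
  positive.\<close>

lemma derivative_pos:
  assumes r: "2 < r"
  shows "0 < (\<integral>p. kZ r p * seclen' r (1 * kZ r p + 0) \<partial>lborel)"
proof -
  have r0: "0 < r" using r by simp
  have c: "0 < cos (1/2::real)" using pi_ge_two by (intro cos_gt_zero) auto
  have pi: "1/2 \<le> pi/2" using pi_ge_two by simp
  let ?B = "cbox (0::real, 0::real) (1/2, 1/2)"
  have "0 < cos (1/2) * measure lborel ?B" using c by (simp add: content_Pair)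
  also have "\<dots> = (\<integral>p. cos (1/2) * indicator ?B p \<partial>lborel)" by simp
  also have "\<dots> \<le> (\<integral>p. kZ r p * seclen' r (1 * kZ r p + 0) \<partial>lborel)"
  proof (rule integral_mono)
    show "integrable lborel (\<lambda>p. cos (1/2) * indicator ?B p :: real)"
      using emeasure_lborel_cbox_finite[of "(0::real, 0::real)" "(1/2, 1/2)"]
      by (intro integrable_mult_right integrable_real_indicator) auto
    show "integrable lborel (\<lambda>p. kZ r p * seclen' r (1 * kZ r p + 0))"
      by (rule has_real_derivative_integral_Z(2)[where ?t0.0 = 1]) (use r in auto)
    fix p :: "real \<times> real"
    obtain x y where p: "p = (x, y)" by (cases p)
    show "cos (1/2) * indicator ?B p \<le> kZ r p * seclen' r (1 * kZ r p + 0)"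
    proof (cases "p \<in> ?B")
      case True
      then have xy: "0 \<le> x" "x \<le> 1/2" "0 \<le> y" "y \<le> 1/2" by (auto simp: p cbox_Pair_eq)
      then have "cos (1/2) \<le> cos x" "cos (1/2) \<le> cos y"
        using pi by (auto intro!: cos_monotone_0_pi_le)
      moreover have "prof r x = cos x" "prof r y = cos y" using xy pi r0 by (auto intro!: prof_le)
      ultimately have k: "cos (1/2) \<le> kZ r p" using xy c by (auto simp: p kZ_def)
      then have "1 \<le> seclen' r (kZ r p)" using c kZ_le[OF r0, of p] r by (intro seclen'_ge_1) auto
      then have "cos (1/2) * 1 \<le> kZ r p * seclen' r (kZ r p)" using k c by (intro mult_mono) auto
      then show ?thesis using True by simp
    next
      case False
      have "0 \<le> kZ r p * seclen' r (kZ r p)"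
        using kZ_nonneg[of r p] kZ_le[OF r0, of p] r by (intro mult_nonneg_nonneg seclen'_nonneg[OF r0]) auto
      then show ?thesis using False by simp
    qed
  qed
  finally show ?thesis .
qed

lemma has_real_derivative_Vol:
  assumes \<omega>: "4 < \<omega>" and \<gamma>: "\<gamma> \<in> Gamma_int \<omega>"
  defines "r \<equiv> sqrt \<omega>"
  shows "(Vol \<omega> has_real_derivative 8 * ((\<integral>p. kZ r p * seclen' r (\<gamma> * kZ r p + 0) \<partial>lborel) -
    ((\<integral>p. kW r {0..} p * seclen' r (1 / \<gamma> * kW r {0..} p + lW r {0..} p) \<partial>lborel) +
     (\<integral>p. kW r {0..pi/2} p * seclen' r (1 / \<gamma> * kW r {0..pi/2} p + lW r {0..pi/2} p) \<partial>lborel)) / \<gamma>\<^sup>2))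
    (at \<gamma> within Gamma_int \<omega>)"
proof -
  have r: "2 < r" using real_sqrt_less_mono[OF \<omega>] by (simp add: r_def)
  have S: "Gamma_int \<omega> = {2/r..r/2}" by (simp add: Gamma_int_def r_def)
  have pos: "0 < g" if "g \<in> {2/r..r/2}" for g
    using that r by (auto intro: less_le_trans[of 0 "2/r"])
  have inv: "1 / g \<in> {2/r..r/2}" if "g \<in> {2/r..r/2}" for g
    using that pos[OF that] r by (auto simp: field_simps)
  have chain: "((\<lambda>g. f (1 / g)) has_real_derivative D * (- 1 / \<gamma>\<^sup>2)) (at \<gamma> within {2/r..r/2})"
    if "(f has_real_derivative D) (at (1 / \<gamma>) within {2/r..r/2})" for f :: "real \<Rightarrow> real" and D
  proof -
    \<comment> \<open>Only derivatives within the interval are available, so the chain rule needs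
      inversion to map the interval into itself.\<close>
    have "(f has_real_derivative D) (at (1 / \<gamma>) within (\<lambda>g. 1 / g) ` {2/r..r/2})"
      by (rule has_field_derivative_subset[OF that]) (use inv in auto)
    moreover have "((\<lambda>g. 1 / g) has_real_derivative - 1 / \<gamma>\<^sup>2) (at \<gamma> within {2/r..r/2})"
      using pos[of \<gamma>] \<gamma> by (auto intro!: derivative_eq_intros simp: S power2_eq_square)
    ultimately have "(f \<circ> (\<lambda>g. 1 / g) has_real_derivative D * (- 1 / \<gamma>\<^sup>2)) (at \<gamma> within {2/r..r/2})"
      by (rule DERIV_image_chain)
    then show ?thesis by (simp add: o_def)
  qed
  note dZ = has_real_derivative_integral_Z(1)[of r \<gamma>]
  note dW = chain[OF has_real_derivative_integral_W(1)[OF r _ _ inv]]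
  have "((\<lambda>g. 8 * ((\<integral>p. seclen r (g * kZ r p + 0) \<partial>lborel) +
    ((\<integral>p. seclen r (1 / g * kW r {0..} p + lW r {0..} p) \<partial>lborel) +
     ((\<integral>p. seclen r (1 / g * kW r {0..pi/2} p + lW r {0..pi/2} p) \<partial>lborel) + pi/2 * (pi/2) * (pi/2)))))
    has_real_derivative 8 * ((\<integral>p. kZ r p * seclen' r (\<gamma> * kZ r p + 0) \<partial>lborel) +
      ((\<integral>p. kW r {0..} p * seclen' r (1 / \<gamma> * kW r {0..} p + lW r {0..} p) \<partial>lborel) * (- 1 / \<gamma>\<^sup>2) +
       ((\<integral>p. kW r {0..pi/2} p * seclen' r (1 / \<gamma> * kW r {0..pi/2} p + lW r {0..pi/2} p) \<partial>lborel) * (- 1 / \<gamma>\<^sup>2) + 0))))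
    (at \<gamma> within {2/r..r/2})"
    using \<gamma> r unfolding S
    by (intro DERIV_cmult DERIV_add DERIV_const dZ dW) auto
  then have "(Vol \<omega> has_real_derivative 8 * ((\<integral>p. kZ r p * seclen' r (\<gamma> * kZ r p + 0) \<partial>lborel) +
      ((\<integral>p. kW r {0..} p * seclen' r (1 / \<gamma> * kW r {0..} p + lW r {0..} p) \<partial>lborel) * (- 1 / \<gamma>\<^sup>2) +
       ((\<integral>p. kW r {0..pi/2} p * seclen' r (1 / \<gamma> * kW r {0..pi/2} p + lW r {0..pi/2} p) \<partial>lborel) * (- 1 / \<gamma>\<^sup>2) + 0))))
    (at \<gamma> within Gamma_int \<omega>)"
    unfolding S[symmetric]
    by (rule has_field_derivative_transform_within[OF _ zero_less_one \<gamma>])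
       (use \<omega> in \<open>auto simp: Vol_eq r_def\<close>)
  then show ?thesis by (rule DERIV_cong) (simp add: add_divide_distrib)
qed

theorem lemmaA2:
  fixes \<omega> :: real
  assumes "\<omega> \<ge> 4"
  shows "(\<omega> > 4 \<longrightarrow>
           (\<forall>\<gamma>\<in>Gamma_int \<omega>. \<gamma> < 1 \<longrightarrow>
              (\<exists>D<0. (Vol \<omega> has_real_derivative D) (at \<gamma> within Gamma_int \<omega>))) \<and>
           (1 \<in> Gamma_int \<omega> \<and> (Vol \<omega> has_real_derivative 0) (at 1 within Gamma_int \<omega>)) \<and>
           (\<forall>\<gamma>\<in>Gamma_int \<omega>. \<gamma> > 1 \<longrightarrow>
              (\<exists>D>0. (Vol \<omega> has_real_derivative D) (at \<gamma> within Gamma_int \<omega>)))) \<and>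
         (\<omega> = 4 \<longrightarrow> Gamma_int \<omega> = {1})"
proof (intro conjI impI)
  show "Gamma_int \<omega> = {1}" if "\<omega> = 4" using that by (simp add: Gamma_int_def)
next
  assume \<omega>: "4 < \<omega>"
  define r where "r = sqrt \<omega>"
  define Z where "Z g = (\<integral>p. kZ r p * seclen' r (g * kZ r p + 0) \<partial>lborel)" for g
  define N where "N t = (\<integral>p. kW r {0..} p * seclen' r (t * kW r {0..} p + lW r {0..} p) \<partial>lborel) +
     (\<integral>p. kW r {0..pi/2} p * seclen' r (t * kW r {0..pi/2} p + lW r {0..pi/2} p) \<partial>lborel)" for t
  have r: "2 < r" using real_sqrt_less_mono[OF \<omega>] by (simp add: r_def)
  have S: "Gamma_int \<omega> = {2/r..r/2}" by (simp add: Gamma_int_def r_def)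
  show one: "1 \<in> Gamma_int \<omega>" using r by (simp add: S)
  have deriv: "(Vol \<omega> has_real_derivative 8 * (Z g - N (1 / g) / g\<^sup>2)) (at g within Gamma_int \<omega>)"
    if "g \<in> Gamma_int \<omega>" for g
    using has_real_derivative_Vol[OF \<omega> that] by (simp add: Z_def N_def r_def)
  have balance: "Z 1 = N 1" using derivative_balance[OF r] by (simp add: Z_def N_def)
  have pos: "0 < N 1" using derivative_pos[OF r] balance by (simp add: Z_def)
  have Z_mono: "Z g \<le> Z g'" if "g \<le> g'" "g' \<le> r/2" for g g'
    unfolding Z_def using r that one
    by (intro has_real_derivative_integral_Z(3)[where ?t0.0 = 1]) (auto simp: S)
  have N_mono: "N t \<le> N t'" if "t \<le> t'" "t' \<le> r/2" for t t'
    unfolding N_def using r that one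
    by (intro add_mono has_real_derivative_integral_W(3)[where ?t0.0 = 1]) (auto simp: S)
  have g0: "0 < g \<and> 1 / g \<le> r/2 \<and> g \<le> r/2" if "g \<in> Gamma_int \<omega>" for g
    using Gamma_intD[OF assms that] by (auto simp: r_def)
  show "(Vol \<omega> has_real_derivative 0) (at 1 within Gamma_int \<omega>)"
    using deriv[OF one] balance by simp
  show "\<forall>\<gamma>\<in>Gamma_int \<omega>. \<gamma> < 1 \<longrightarrow>
      (\<exists>D<0. (Vol \<omega> has_real_derivative D) (at \<gamma> within Gamma_int \<omega>))"
  proof (intro ballI impI exI conjI)
    fix g assume g: "g \<in> Gamma_int \<omega>" "g < 1"
    have "Z g \<le> N 1" using Z_mono[of g 1] g g0[OF g(1)] balance r by simp
    \<comment> \<open>The only strict step: monotonicity of \<open>Z\<close> and \<open>N\<close> is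
      weak, and strictness comes from the inner derivative of \<open>1 / \<gamma>\<close> together
      with \<open>N 1 > 0\<close>.\<close>
    also have "N 1 < N 1 / g\<^sup>2"
      using g g0[OF g(1)] pos by (simp add: field_simps power_less_one_iff)
    also have "N 1 / g\<^sup>2 \<le> N (1 / g) / g\<^sup>2"
      using N_mono[of 1 "1 / g"] g g0[OF g(1)] by (intro divide_right_mono) auto
    finally show "8 * (Z g - N (1 / g) / g\<^sup>2) < 0" by simp
  qed (rule deriv)
  show "\<forall>\<gamma>\<in>Gamma_int \<omega>. \<gamma> > 1 \<longrightarrow>
      (\<exists>D>0. (Vol \<omega> has_real_derivative D) (at \<gamma> within Gamma_int \<omega>))"
  proof (intro ballI impI exI conjI)
    fix g assume g: "g \<in> Gamma_int \<omega>" "1 < g"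
    have "N (1 / g) / g\<^sup>2 \<le> N 1 / g\<^sup>2"
      using N_mono[of "1 / g" 1] g r by (intro divide_right_mono) auto
    also have "N 1 / g\<^sup>2 < N 1"
      using g pos one_less_power[of g 2] by (simp add: field_simps)
    also have "N 1 \<le> Z g" using Z_mono[of 1 g] g g0[OF g(1)] balance by simp
    finally show "0 < 8 * (Z g - N (1 / g) / g\<^sup>2)" by simp
  qed (rule deriv)
qed

end
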